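(* Let $p,q$ be integers with $5 \le p \le q$, and let $K(3,p,q)$ be the complete tripartite graph with parts of sizes $3$, $p$, $q$. Then $$f(K(3,p,q)) = \begin{cases} 2, & \text{if } p \le q < \binom{p+1}{\lfloor \frac{p+1}{2} \rfloor};\\ 3, & \text{if } q \ge \binom{p+1}{\lfloor \frac{p+1}{2} \rfloor}.\end{cases}$$
   Context: For a bridgeless connected graph $G$, a strong orientation of $G$ is an assignment of a direction to each edge such that the resulting digraph is strongly connected. The diameter $\mathrm{diam}(D)$ of a strongly connected digraph $D$ is the maximum over ordered pairs of vertices $(u,v)$ of the length of a shortest directed path from $u$ to $v$. The oriented diameter of $G$ is $f(G)=\min\{\mathrm{diam}(D) : D \text{ a strong orientation of } G\}$. *)

theory Defs
  imports "Graph_Theory.Digraph_Component" "Graph_Theory.Shortest_Path"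
begin

text \<open>
  Undirected graphs are symmetric digraphs, as in the library locale \<open>pair_graph\<close>:
  an edge joining \<open>u\<close> and \<open>v\<close> is the pair of arcs \<open>(u, v)\<close>, \<open>(v, u)\<close>.
  An orientation keeps exactly one arc of each such pair.
\<close>

definition orientation :: "'a pair_pre_digraph \<Rightarrow> 'a pair_pre_digraph \<Rightarrow> bool" where
  "orientation G D \<longleftrightarrow>
     pverts D = pverts G \<and> parcs D \<subseteq> parcs G \<and>
     (\<forall>(u, v) \<in> parcs G. (u, v) \<in> parcs D \<longleftrightarrow> (v, u) \<notin> parcs D)"

definition strong_orientation :: "'a pair_pre_digraph \<Rightarrow> 'a pair_pre_digraph \<Rightarrow> bool" where
  "strong_orientation G D \<longleftrightarrow> orientation G D \<and> strongly_connected (with_proj D)"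

text \<open>
  The library's \<open>\<mu>\<close> is the least cost of a directed walk between two vertices; with
  unit costs it is the length of a shortest directed path, and \<open>\<infinity>\<close> if there is none.
  It is specified for well-formed digraphs only, which orientations of graphs are
  (see below). If a digraph has finitely many vertices, and at least one, the supremum
  is a maximum.
\<close>

definition diam :: "('a, 'b) pre_digraph \<Rightarrow> ereal" where
  "diam D = (SUP (u, v) \<in> verts D \<times> verts D. wf_digraph.\<mu> D (\<lambda>_. 1) u v)"

text \<open>
  A finite graph has finitely many strong orientations, so the infimum is a minimum unless
  there is none, in which case the value is \<open>\<infinity>\<close>.
\<close>

definition oriented_diameter :: "'a pair_pre_digraph \<Rightarrow> ereal" where
  "oriented_diameter G = (INF D \<in> {D. strong_orientation G D}. diam (with_proj D))"

text \<open>The vertex \<open>(i, j)\<close> is the \<open>j\<close>-th vertex of the \<open>i\<close>-th part.\<close>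

definition complete_tripartite :: "nat \<Rightarrow> nat \<Rightarrow> nat \<Rightarrow> (nat \<times> nat) pair_pre_digraph" where
  "complete_tripartite l m n =
     (let V = {0} \<times> {..<l} \<union> {1} \<times> {..<m} \<union> {2} \<times> {..<n}
      in \<lparr> pverts = V, parcs = {(x, y). x \<in> V \<and> y \<in> V \<and> fst x \<noteq> fst y} \<rparr>)"

lemma pair_graph_complete_tripartite: "pair_graph (complete_tripartite l m n)"
proof -
  let ?K = "complete_tripartite l m n"
  have fin: "finite (pverts ?K)"
    by (simp add: complete_tripartite_def Let_def)
  have sub: "parcs ?K \<subseteq> pverts ?K \<times> pverts ?K"
    by (auto simp: complete_tripartite_def Let_def)
  have "finite (parcs ?K)"
    using finite_subset[OF sub] fin by blast
  moreover have "symmetric (with_proj ?K)"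
    by (auto simp: symmetric_def sym_def complete_tripartite_def Let_def)
  moreover have "\<And>e. e \<in> parcs ?K \<Longrightarrow> fst e \<noteq> snd e"
    by (auto simp: complete_tripartite_def Let_def)
  ultimately show ?thesis
    using fin sub by unfold_locales auto
qed

lemma pair_digraph_orientation:
  assumes "pair_graph G" "orientation G D"
  shows "pair_digraph D"
proof -
  interpret pair_graph G by (rule assms(1))
  have D: "pverts D = pverts G" "parcs D \<subseteq> parcs G"
    using assms(2) by (auto simp: orientation_def)
  have "finite (parcs D)"
    using D(2) pair_finite_arcs finite_subset by blast
  moreover have "fst e \<in> pverts D" "snd e \<in> pverts D" "fst e \<noteq> snd e" if "e \<in> parcs D" for e
    using that D arc_fst_in_verts[of e] arc_snd_in_verts[of e] pair_no_loops[of e] by blast+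
  ultimately show ?thesis
    using D(1) pair_finite_verts by unfold_locales simp_all
qed

end

theory Submission
  imports Defs "HOL-Combinatorics.Multiset_Permutations"
begin

text \<open>
  Let the part of size 3 be \<open>{0, 1, 2}\<close> and let \<open>A i\<close> be the set of out-neighbours of \<open>i\<close> in the part
  of size \<open>p\<close>. A vertex of the part of size \<open>q\<close> is described by the pair \<open>(S, T)\<close> of its sets of
  out-neighbours in the other two parts. In an orientation of diameter 2 these pairs form an
  antichain, \<open>i \<in> S\<close> excludes \<open>A i \<subseteq> T\<close>, and \<open>i \<notin> S\<close> excludes \<open>T \<subseteq> A i\<close>. Hence the pairs with
  first component \<open>S\<close> or \<open>S \<union> {i}\<close> amount to an antichain of subsets of a set with \<open>p + 1\<close> elements
  that misses some maximal chain through \<open>A i\<close>, and the LYM inequality bounds their number by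
  \<open>((p + 1) choose ((p + 1) div 2)) - 1\<close>. If other values of \<open>S\<close> occur as well, then the distances
  between the parts of sizes \<open>p\<close> and \<open>q\<close> determine \<open>T\<close> on so many vertices that Sperner's bound
  for each value of \<open>S\<close> suffices.

  The bound is attained with \<open>A 0\<close> everything, \<open>A 2\<close> empty and \<open>A 1\<close> of size \<open>m = (p + 1) div 2\<close>: take
  \<open>S = {0}\<close> with \<open>card T = m\<close> and \<open>T \<noteq> A 1\<close>, and \<open>S = {0, 1}\<close> with \<open>card T = m - 1\<close>. At most \<open>p\<close> of these
  pairs already make all distances at most 2 outside the part of size \<open>q\<close>, so any number of pairs
  from \<open>p\<close> up to the maximum can be realised. Repeating pairs for larger \<open>q\<close> gives diameter 3.
\<close>

section \<open>Antichains of sets\<close>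

text \<open>Permutations encode maximal chains: the prefixes of a list are the members of its chain.
  A chain through \<open>A\<close> is a permutation of \<open>A\<close> followed by one of
  \<open>U - A\<close>, and the cut after \<open>card A\<close> entries is unique.\<close>

lemma permutations_with_prefix_set:
  assumes "finite U" "A \<subseteq> U"
  shows "card {xs \<in> permutations_of_set U. set (take (card A) xs) = A} =
    fact (card A) * fact (card U - card A)"
proof -
  have fA: "finite A" using assms finite_subset by blast
  have eq: "{xs \<in> permutations_of_set U. set (take (card A) xs) = A} =
      (\<lambda>(ys, zs). ys @ zs) ` (permutations_of_set A \<times> permutations_of_set (U - A))"
  proof (intro equalityI subsetI)
    fix xs assume "xs \<in> {xs \<in> permutations_of_set U. set (take (card A) xs) = A}"
    then have xs: "set xs = U" "distinct xs" "set (take (card A) xs) = A"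
      by (auto simp: permutations_of_set_def)
    have "set (drop (card A) xs) = U - A"
      using xs set_take_disj_set_drop_if_distinct[of xs "card A" "card A"]
      by (metis Diff_cancel Diff_triv Un_Diff Un_empty_left append_take_drop_id inf_commute order_refl set_append)
    then have "take (card A) xs \<in> permutations_of_set A"
      "drop (card A) xs \<in> permutations_of_set (U - A)"
      using xs by (auto simp: permutations_of_set_def)
    then show "xs \<in> (\<lambda>(ys, zs). ys @ zs) ` (permutations_of_set A \<times> permutations_of_set (U - A))"
      by (intro image_eqI[of _ _ "(take (card A) xs, drop (card A) xs)"]) auto
  next
    fix xs assume "xs \<in> (\<lambda>(ys, zs). ys @ zs) ` (permutations_of_set A \<times> permutations_of_set (U - A))"
    then obtain ys zs where "xs = ys @ zs" "set ys = A" "distinct ys" "set zs = U - A" "distinct zs"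
      by (auto simp: permutations_of_set_def)
    moreover from this have "length ys = card A" using distinct_card by fastforce
    ultimately show "xs \<in> {xs \<in> permutations_of_set U. set (take (card A) xs) = A}"
      using assms by (auto simp: permutations_of_set_def)
  qed
  have "length ys = card A" if "ys \<in> permutations_of_set A" for ys
    using that distinct_card by (fastforce simp: permutations_of_set_def)
  then have "inj_on (\<lambda>(ys, zs). ys @ zs) (permutations_of_set A \<times> permutations_of_set (U - A))"
    by (intro inj_onI) auto
  then show ?thesis
    using assms fA by (simp add: eq card_image card_Diff_subset)
qed

text \<open>A chain meets an antichain at most once, so the sets of chains through the various
  members of \<open>F\<close> are disjoint.\<close>

lemma card_antichain_chains:
  fixes F :: "'a set set"
  assumes "finite U" "F \<subseteq> Pow U" and antichain: "\<And>A B. A \<in> F \<Longrightarrow> B \<in> F \<Longrightarrow> A \<subseteq> B \<Longrightarrow> A = B"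
  shows "(\<Sum>A\<in>F. fact (card A) * fact (card U - card A)) =
    card {xs \<in> permutations_of_set U. \<exists>k. set (take k xs) \<in> F}"
proof -
  have finF: "finite F" using assms(1) finite_subset[OF assms(2)] by simp
  define Q where "Q A = {xs \<in> permutations_of_set U. set (take (card A) xs) = A}" for A
  have eq: "{xs \<in> permutations_of_set U. \<exists>k. set (take k xs) \<in> F} = (\<Union>A\<in>F. Q A)"
  proof (intro equalityI subsetI)
    fix xs assume "xs \<in> {xs \<in> permutations_of_set U. \<exists>k. set (take k xs) \<in> F}"
    then obtain k where k: "xs \<in> permutations_of_set U" "set (take k xs) \<in> F" by auto
    \<comment> \<open>The index \<open>k\<close> may exceed the length of \<open>xs\<close>; the
      cardinality of the prefix is the canonical index.\<close>
    have "card (set (take k xs)) = min (length xs) k"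
      using k by (metis distinct_card distinct_take length_take permutations_of_setD(2))
    then have "take (card (set (take k xs))) xs = take k xs"
      by (simp add: min_def)
    with k(1) show "xs \<in> (\<Union>A\<in>F. Q A)"
      by (intro UN_I[OF k(2)]) (simp add: Q_def)
  next
    fix xs assume "xs \<in> (\<Union>A\<in>F. Q A)"
    then obtain A where "A \<in> F" "xs \<in> permutations_of_set U" "set (take (card A) xs) = A"
      by (auto simp: Q_def)
    then show "xs \<in> {xs \<in> permutations_of_set U. \<exists>k. set (take k xs) \<in> F}"
      by (simp add: exI[of _ "card A"])
  qed
  have disj: "Q A \<inter> Q B = {}" if "A \<in> F" "B \<in> F" "A \<noteq> B" for A B
  proof (rule ccontr)
    assume "Q A \<inter> Q B \<noteq> {}"
    then obtain xs where "set (take (card A) xs) = A" "set (take (card B) xs) = B"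
      by (auto simp: Q_def)
    then have "A \<subseteq> B \<or> B \<subseteq> A"
      by (metis nle_le set_take_subset_set_take)
    with antichain that show False by blast
  qed
  have "card (\<Union>A\<in>F. Q A) = (\<Sum>A\<in>F. card (Q A))"
    using finF disj by (intro card_UN_disjoint) (auto simp: Q_def)
  also have "\<dots> = (\<Sum>A\<in>F. fact (card A) * fact (card U - card A))"
    unfolding Q_def using assms(1,2) by (intro sum.cong refl permutations_with_prefix_set) auto
  finally show ?thesis unfolding eq by simp
qed

text \<open>The share of all chains that pass through a fixed set is the inverse of a binomial
  coefficient, hence at least the inverse of the central one.\<close>

lemma fact_le_fact_mult_central:
  assumes "k \<le> n"
  shows "(fact n :: nat) \<le> fact k * fact (n - k) * (n choose (n div 2))"
proof -
  have "(fact n :: nat) = fact k * fact (n - k) * (n choose k)"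
    using binomial_fact_lemma[OF assms] by simp
  also have "\<dots> \<le> fact k * fact (n - k) * (n choose (n div 2))"
    by (intro mult_left_mono binomial_maximum) auto
  finally show ?thesis .
qed

text \<open>Double counting of pairs of a member of \<open>F\<close> and a chain through it. A
  single chain that misses \<open>F\<close> makes the count strict, which is the source of the
  strict inequality in the threshold.\<close>

lemma sperner:
  fixes F :: "'a set set"
  assumes "finite U" "F \<subseteq> Pow U" "\<And>A B. A \<in> F \<Longrightarrow> B \<in> F \<Longrightarrow> A \<subseteq> B \<Longrightarrow> A = B"
  shows "card F \<le> card U choose (card U div 2)"
    and "xs \<in> permutations_of_set U \<Longrightarrow> (\<And>k. set (take k xs) \<notin> F) \<Longrightarrow>
      card F < card U choose (card U div 2)"
proof -
  let ?n = "card U" and ?H = "{xs \<in> permutations_of_set U. \<exists>k. set (take k xs) \<in> F}"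
  have "card F * fact ?n \<le> (\<Sum>A\<in>F. fact (card A) * fact (?n - card A) * (?n choose (?n div 2)))"
  proof -
    have "fact ?n \<le> fact (card A) * fact (?n - card A) * (?n choose (?n div 2))" if "A \<in> F" for A
      using assms(1,2) that by (intro fact_le_fact_mult_central card_mono) auto
    from sum_mono[OF this] show ?thesis by simp
  qed
  also have "\<dots> = card ?H * (?n choose (?n div 2))"
    by (simp only: sum_distrib_right[symmetric] card_antichain_chains[OF assms])
  finally have le: "card F * fact ?n \<le> card ?H * (?n choose (?n div 2))" .
  have fin: "finite (permutations_of_set U)" and card: "card (permutations_of_set U) = fact ?n"
    using assms(1) by (simp_all add: card_permutations_of_set)
  have "card ?H \<le> fact ?n"
    unfolding card[symmetric] using fin by (rule card_mono) auto
  then have "card ?H * (?n choose (?n div 2)) \<le> fact ?n * (?n choose (?n div 2))"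
    by (rule mult_le_mono1)
  with le have "card F * fact ?n \<le> fact ?n * (?n choose (?n div 2))"
    by (rule le_trans)
  then show "card F \<le> ?n choose (?n div 2)" by simp
  assume "xs \<in> permutations_of_set U" "\<And>k. set (take k xs) \<notin> F"
  then have "?H \<subset> permutations_of_set U" by auto
  with fin have "card ?H < fact ?n"
    unfolding card[symmetric] by (rule psubset_card_mono)
  then have "card ?H * (?n choose (?n div 2)) < fact ?n * (?n choose (?n div 2))"
    by simp
  with le have "card F * fact ?n < fact ?n * (?n choose (?n div 2))"
    by (rule le_less_trans)
  then show "card F < ?n choose (?n div 2)" by simp
qed

section \<open>Central binomial coefficients\<close>

definition central :: "nat \<Rightarrow> nat" where
  "central n = n choose (n div 2)"

lemma central_mono: "m \<le> n \<Longrightarrow> central m \<le> central n"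
proof (induction n rule: dec_induct)
  case (step n)
  have "n choose (n div 2) \<le> Suc n choose (n div 2)"
    by (cases "n div 2") auto
  also have "\<dots> \<le> Suc n choose (Suc n div 2)" by (rule binomial_maximum)
  finally show ?case using step by (simp add: central_def)
qed simp

lemma central_0 [simp]: "central 0 = 1" and central_1 [simp]: "central (Suc 0) = 1"
  by (simp_all add: central_def)

lemma central_ge_2: "2 \<le> n \<Longrightarrow> 2 \<le> central n"
  using central_mono[of 2 n] by (simp add: central_def)

lemma central_even: "central (2 * k) = (2 * k) choose k"
  by (simp add: central_def)

lemma central_odd: "central (Suc (2 * k)) = Suc (2 * k) choose k"
  "central (Suc (2 * k)) = Suc (2 * k) choose Suc k"
  using binomial_symmetric[of k "Suc (2 * k)"] by (simp_all add: central_def)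

lemma binomial_Suc_Suc_twice:
  "Suc (Suc n) choose Suc (Suc k) = (n choose k) + 2 * (n choose Suc k) + (n choose Suc (Suc k))"
  by simp

text \<open>Pascal's rule expands every term in the binomial coefficients of row \<open>n\<close>,
  after which the comparison is linear. The estimates are used with \<open>p = n + 3\<close>, so
  that \<open>central (n + 4)\<close> is the bound to be beaten.\<close>

lemma central_ineqs:
  assumes "2 \<le> n"
  shows "central (n + 3) + central (n + 2) + central n + 2 \<le> central (n + 4)"
    and "3 * central (n + 2) + 2 \<le> central (n + 4)"
    and "central (n + 3) + 2 * central (n + 1) + 2 \<le> central (n + 4)"
    and "2 * central (n + 1) \<le> central (n + 3)"
    and "Suc (central n) \<le> central (n + 1)"
    and "Suc (central (n + 1)) \<le> central (n + 2)"
proof -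
  have "central (n + 3) + central (n + 2) + central n + 2 \<le> central (n + 4) \<and>
    3 * central (n + 2) + 2 \<le> central (n + 4) \<and>
    central (n + 3) + 2 * central (n + 1) + 2 \<le> central (n + 4) \<and>
    2 * central (n + 1) \<le> central (n + 3) \<and> Suc (central n) \<le> central (n + 1) \<and>
    Suc (central (n + 1)) \<le> central (n + 2)"
  proof (cases "even n")
    case True
    then obtain j where j: "n = 2 * Suc j" using assms
      by (metis dvdE mult_0_right not0_implies_Suc not_numeral_le_zero)
    \<comment> \<open>The middle coefficient of row \<open>n\<close> and its successive neighbours
      outwards.\<close>
    define a b c where "a = n choose Suc j" "b = n choose j" "c = n choose Suc (Suc (Suc j))"
    have sym: "n choose Suc (Suc j) = b"
      unfolding a_b_c_def using binomial_symmetric[of j n] j by simp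
    \<comment> \<open>In the first inequality the multiples of \<open>a\<close> cancel, so the
      additive 2 must come from \<open>b\<close>.\<close>
    have b: "0 < b" using j by (simp add: a_b_c_def)
    have 0: "central n = a"
      using central_even[of "Suc j"] by (simp only: j[symmetric] a_b_c_def)
    have 1: "central (n + 1) = a + b"
      using central_odd(1)[of "Suc j"] by (simp only: j[symmetric]) (simp add: a_b_c_def)
    have "n + 2 = 2 * Suc (Suc j)" using j by simp
    then have "central (n + 2) = Suc (Suc n) choose Suc (Suc j)"
      using central_even[of "Suc (Suc j)"] by (metis add_2_eq_Suc')
    then have 2: "central (n + 2) = 2 * a + 2 * b"
      unfolding binomial_Suc_Suc_twice sym by (simp add: a_b_c_def)
    have "central (n + 3) = Suc (Suc (Suc n)) choose Suc (Suc (Suc j))"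
      using central_odd(2)[of "Suc (Suc j)"] j by (simp add: numeral_3_eq_3)
    also have "\<dots> = (Suc (Suc n) choose Suc (Suc j)) + (Suc (Suc n) choose Suc (Suc (Suc j)))"
      by (rule binomial_Suc_Suc)
    finally have 3: "central (n + 3) = 3 * a + 4 * b + c"
      unfolding binomial_Suc_Suc_twice sym by (simp add: a_b_c_def)
    have "central (n + 4) = Suc (n + 3) choose Suc (Suc (Suc j))"
      using central_even[of "Suc (Suc (Suc j))"] j by (simp add: numeral_eq_Suc)
    also have "\<dots> = 2 * central (n + 3)"
      using central_odd[of "Suc (Suc j)"] j by (simp add: numeral_eq_Suc)
    finally have 4: "central (n + 4) = 6 * a + 8 * b + 2 * c" using 3 by simp
    show ?thesis unfolding 0 1 2 3 4 using b by simp
  next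
    case False
    then obtain k where k: "n = Suc (2 * k)" by (metis oddE Suc_eq_plus1)
    define a b c where "a = n choose Suc k" "b = n choose Suc (Suc k)" "c = n choose Suc (Suc (Suc k))"
    have sym: "n choose k = a"
      unfolding a_b_c_def using binomial_symmetric[of k n] k by simp
    have pos: "0 < a" "0 < b" using k assms by (auto simp: a_b_c_def)
    have 0: "central n = a"
      using central_odd(2)[of k] by (simp only: k[symmetric] a_b_c_def)
    have "2 \<le> a" using central_ge_2[OF assms] 0 by simp
    have "n + 1 = 2 * Suc k" using k by simp
    then have "central (n + 1) = Suc n choose Suc k"
      using central_even[of "Suc k"] by (metis Suc_eq_plus1)
    then have 1: "central (n + 1) = 2 * a"
      using sym by (simp add: a_b_c_def)
    have "central (n + 2) = Suc (Suc n) choose Suc (Suc k)"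
      using central_odd(2)[of "Suc k"] k by (simp add: numeral_eq_Suc)
    then have 2: "central (n + 2) = 3 * a + b"
      unfolding binomial_Suc_Suc_twice sym by (simp add: a_b_c_def)
    have 3: "Suc (n + 2) choose Suc (Suc k) = 2 * central (n + 2)"
      using central_odd[of "Suc k"] k by (simp add: numeral_eq_Suc)
    then have 4: "central (n + 3) = 6 * a + 2 * b"
      using central_even[of "Suc (Suc k)"] k 2 by (simp add: numeral_eq_Suc)
    have "central (n + 4) = Suc (Suc (n + 2)) choose Suc (Suc (Suc k))"
      using central_odd(2)[of "Suc (Suc k)"] k by (simp add: numeral_eq_Suc)
    also have "\<dots> = (Suc (n + 2) choose Suc (Suc k)) + (Suc (n + 2) choose Suc (Suc (Suc k)))"
      by (rule binomial_Suc_Suc)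
    also have "Suc (n + 2) choose Suc (Suc (Suc k)) =
        (Suc (Suc n) choose Suc (Suc k)) + (Suc (Suc n) choose Suc (Suc (Suc k)))"
      by simp
    finally have 5: "central (n + 4) = 10 * a + 5 * b + c"
      unfolding binomial_Suc_Suc_twice sym 3 2 by (simp add: a_b_c_def)
    show ?thesis unfolding 0 1 2 4 5 using pos \<open>2 \<le> a\<close> by simp
  qed
  then show "central (n + 3) + central (n + 2) + central n + 2 \<le> central (n + 4)"
    "3 * central (n + 2) + 2 \<le> central (n + 4)"
    "central (n + 3) + 2 * central (n + 1) + 2 \<le> central (n + 4)"
    "2 * central (n + 1) \<le> central (n + 3)" "Suc (central n) \<le> central (n + 1)"
    "Suc (central (n + 1)) \<le> central (n + 2)" by simp_all
qed

section \<open>Estimates on the hexagon of proper subsets\<close>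

text \<open>
  A vertex \<open>y\<close> of the part of size \<open>p\<close> has the type \<open>{i. y \<in> A i}\<close>. The sets \<open>{0}\<close>, \<open>{0, 1}\<close>, \<open>{1}\<close>,
  \<open>{1, 2}\<close>, \<open>{2}\<close>, \<open>{2, 0}\<close> are the nodes 0, ..., 5 of a hexagon: \<open>nk\<close> is the number of vertices of
  type \<open>k\<close>, and \<open>Nk\<close> the number of pairs \<open>(S, T)\<close> with \<open>S\<close> the node \<open>k\<close>. Likewise \<open>e\<close>, \<open>a\<close> belong to the
  empty set, and \<open>f\<close>, \<open>b\<close> to \<open>{0, 1, 2}\<close>. If \<open>S\<close> is the node \<open>k\<close>, then type \<open>k + 3\<close> is absent, and
  \<open>T\<close> is only free on the types \<open>k - 1\<close>, \<open>k\<close>, \<open>k + 1\<close>. Rotation by one step corresponds to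
  reversing all arcs, up to a permutation of \<open>{0, 1, 2}\<close>; it exchanges the poles \<open>{}\<close> and \<open>{0, 1, 2}\<close>.
\<close>

definition node_bound :: "nat \<Rightarrow> nat \<Rightarrow> nat \<Rightarrow> nat \<Rightarrow> nat \<Rightarrow> nat \<Rightarrow> nat \<Rightarrow> nat \<Rightarrow> nat \<Rightarrow> bool" where
  "node_bound e f n0 n1 n2 n3 n4 n5 N \<longleftrightarrow> N \<le> central (n5 + n0 + n1) \<and>
     (e + n4 + n5 = 0 \<longrightarrow> n0 = 1 \<longrightarrow> N \<le> central n1) \<and>
     (e + n1 + n2 = 0 \<longrightarrow> n0 = 1 \<longrightarrow> N \<le> central n5) \<and>
     (N \<noteq> 0 \<longrightarrow> n3 = 0 \<and> 0 < f + n5 + n0 + n1 \<and> 0 < e + n4 + n5 + n0 \<and> 0 < e + n0 + n1 + n2)"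

text \<open>For \<open>S\<close> empty, \<open>T\<close> is forced, so there is at most one pair;
  type \<open>{0, 1, 2}\<close> is then absent, and the three sums are the sizes of the sets
  \<open>Y - A i\<close>. After rotation by one step they are the sizes of the
  \<open>A i\<close>.\<close>

definition pole_bound :: "nat \<Rightarrow> nat \<Rightarrow> nat \<Rightarrow> nat \<Rightarrow> nat \<Rightarrow> nat \<Rightarrow> nat \<Rightarrow> nat \<Rightarrow> nat \<Rightarrow> bool" where
  "pole_bound e f n0 n1 n2 n3 n4 n5 a \<longleftrightarrow> a \<le> 1 \<and>
     (a \<noteq> 0 \<longrightarrow> f = 0 \<and> 0 < e + n0 + n1 + n2 \<and> 0 < e + n2 + n3 + n4 \<and> 0 < e + n4 + n5 + n0)"

text \<open>This collects all numerical consequences of diameter 2, so that the case analysis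
  involves no sets. The sums of neighbouring \<open>Nk\<close> come from
  \<open>card_two_layers_less\<close>; \<open>e\<close> and \<open>f\<close> alternate because one
  step of rotation reverses the arcs.\<close>

definition hexagon where
  "hexagon M t e f a b n0 n1 n2 n3 n4 n5 N0 N1 N2 N3 N4 N5 \<longleftrightarrow>
     5 \<le> e + f + n0 + n1 + n2 + n3 + n4 + n5 \<and>
     M = central (e + f + n0 + n1 + n2 + n3 + n4 + n5 + 1) \<and>
     t = a + b + N0 + N1 + N2 + N3 + N4 + N5 \<and> e \<le> 1 \<and> f \<le> 1 \<and>
     N0 + N1 < M \<and> N1 + N2 < M \<and> N2 + N3 < M \<and> N3 + N4 < M \<and> N4 + N5 < M \<and> N5 + N0 < M \<and>
     pole_bound e f n0 n1 n2 n3 n4 n5 a \<and> pole_bound f e n1 n2 n3 n4 n5 n0 b \<and>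
     node_bound e f n0 n1 n2 n3 n4 n5 N0 \<and> node_bound f e n1 n2 n3 n4 n5 n0 N1 \<and>
     node_bound e f n2 n3 n4 n5 n0 n1 N2 \<and> node_bound f e n3 n4 n5 n0 n1 n2 N3 \<and>
     node_bound e f n4 n5 n0 n1 n2 n3 N4 \<and> node_bound f e n5 n0 n1 n2 n3 n4 N5"

lemma pole_bound_rotate: "pole_bound e f n0 n1 n2 n3 n4 n5 a \<Longrightarrow> pole_bound e f n2 n3 n4 n5 n0 n1 a"
  unfolding pole_bound_def by auto

lemma pole_bound_reflect: "pole_bound e f n0 n1 n2 n3 n4 n5 a \<Longrightarrow> pole_bound e f n0 n5 n4 n3 n2 n1 a"
  unfolding pole_bound_def by auto

lemma node_bound_reflect: "node_bound e f n0 n1 n2 n3 n4 n5 a \<Longrightarrow> node_bound e f n0 n5 n4 n3 n2 n1 a"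
  unfolding node_bound_def by (auto simp: add.commute add.left_commute)

lemma hexagon_rotate:
  "hexagon M t e f a b n0 n1 n2 n3 n4 n5 N0 N1 N2 N3 N4 N5 \<Longrightarrow>
   hexagon M t f e b a n1 n2 n3 n4 n5 n0 N1 N2 N3 N4 N5 N0"
  unfolding hexagon_def by (simp add: add.commute add.left_commute pole_bound_rotate)

lemma hexagon_reflect:
  "hexagon M t e f a b n0 n1 n2 n3 n4 n5 N0 N1 N2 N3 N4 N5 \<Longrightarrow>
   hexagon M t e f a b n0 n5 n4 n3 n2 n1 N0 N5 N4 N3 N2 N1"
  unfolding hexagon_def
  using pole_bound_rotate[OF pole_bound_reflect[of f e n1 n2 n3 n4 n5 n0 b]]
  by (simp add: add.commute add.left_commute pole_bound_reflect node_bound_reflect)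

text \<open>The numbers \<open>ci\<close> stand for \<open>central (p - i)\<close>; as variables they keep the estimates linear.\<close>

definition row_bounds :: "nat \<Rightarrow> nat \<Rightarrow> nat \<Rightarrow> nat \<Rightarrow> nat \<Rightarrow> nat \<Rightarrow> bool" where
  "row_bounds p M c0 c1 c2 c3 \<longleftrightarrow>
     (\<forall>n. (n \<le> p \<longrightarrow> central n \<le> c0) \<and> (n + 1 \<le> p \<longrightarrow> central n \<le> c1) \<and>
       (n + 2 \<le> p \<longrightarrow> central n \<le> c2) \<and> (n + 3 \<le> p \<longrightarrow> central n \<le> c3)) \<and>
     c0 + c1 + c3 + 2 \<le> M \<and> 3 * c1 + 2 \<le> M \<and> c0 + 2 * c2 + 2 \<le> M \<and> 2 * c2 \<le> c0 \<and>
     c3 < c2 \<and> c2 < c1 \<and> 2 \<le> c3 \<and> 5 \<le> p"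

lemma row_bounds_exist:
  assumes "5 \<le> p"
  shows "\<exists>c0 c1 c2 c3. row_bounds p (central (p + 1)) c0 c1 c2 c3"
proof -
  obtain n where n: "p = n + 3" "2 \<le> n" using assms le_Suc_ex[of 5 p] by force
  then have "row_bounds p (central (p + 1)) (central p) (central (n + 2)) (central (n + 1)) (central n)"
    using central_ineqs[of n] central_ge_2[of n] unfolding row_bounds_def
    by (auto intro: central_mono simp: numeral_eq_Suc)
  then show ?thesis by blast
qed

lemma row_boundsD:
  assumes "row_bounds p M c0 c1 c2 c3"
  shows "n \<le> p \<Longrightarrow> central n \<le> c0" "n + 1 \<le> p \<Longrightarrow> central n \<le> c1"
    "n + 2 \<le> p \<Longrightarrow> central n \<le> c2" "n + 3 \<le> p \<Longrightarrow> central n \<le> c3"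
    "c0 + c1 + c3 + 2 \<le> M" "3 * c1 + 2 \<le> M" "c0 + 2 * c2 + 2 \<le> M" "2 * c2 \<le> c0"
    "c3 < c2" "c2 < c1" "2 \<le> c3" "5 \<le> p"
  using assms unfolding row_bounds_def by blast+

lemma hexagonD:
  assumes "hexagon M t e f a b n0 n1 n2 n3 n4 n5 N0 N1 N2 N3 N4 N5"
  shows "t = a + b + N0 + N1 + N2 + N3 + N4 + N5" "e = 0 \<or> e = 1" "f = 0 \<or> f = 1"
    "N0 + N1 < M"
    "pole_bound e f n0 n1 n2 n3 n4 n5 a" "pole_bound f e n1 n2 n3 n4 n5 n0 b"
    "node_bound e f n0 n1 n2 n3 n4 n5 N0" "node_bound f e n1 n2 n3 n4 n5 n0 N1"
    "node_bound e f n2 n3 n4 n5 n0 n1 N2" "node_bound f e n3 n4 n5 n0 n1 n2 N3"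
    "node_bound e f n4 n5 n0 n1 n2 n3 N4" "node_bound f e n5 n0 n1 n2 n3 n4 N5"
  using assms unfolding hexagon_def by auto

lemma hexagon_row:
  assumes "hexagon M t e f a b n0 n1 n2 n3 n4 n5 N0 N1 N2 N3 N4 N5"
  shows "\<exists>p c0 c1 c2 c3. e + f + n0 + n1 + n2 + n3 + n4 + n5 = p \<and> row_bounds p M c0 c1 c2 c3"
  using assms row_bounds_exist unfolding hexagon_def by blast

section \<open>Case analysis over the set of occurring types\<close>

lemma hexagon_none:
  assumes "hexagon M t e f a b n0 n1 n2 n3 n4 n5 N0 N1 N2 N3 N4 N5"
  shows "n0 = 0 \<and> n1 = 0 \<and> n2 = 0 \<and> n3 = 0 \<and> n4 = 0 \<and> n5 = 0 \<longrightarrow> t < M"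
  \<comment> \<open>Vacuous: \<open>e + f <= 2\<close> contradicts the required total of at least
    5.\<close>
  using assms by (auto simp: hexagon_def)

text \<open>The digits in the names of this and the following lemmas are the nodes with nonzero
  count. The layers not excluded by \<open>node_bound\<close> are estimated by central coefficients,
  and each vertex at a pole shortens the row by one.\<close>

lemma hexagon_0:
  assumes h: "hexagon M t e f a b n0 n1 n2 n3 n4 n5 N0 N1 N2 N3 N4 N5"
  shows "n0 \<noteq> 0 \<and> n1 = 0 \<and> n2 = 0 \<and> n3 = 0 \<and> n4 = 0 \<and> n5 = 0 \<longrightarrow> t < M"
proof
  assume z: "n0 \<noteq> 0 \<and> n1 = 0 \<and> n2 = 0 \<and> n3 = 0 \<and> n4 = 0 \<and> n5 = 0"
  note N = hexagonD(1,5-)[OF h, unfolded node_bound_def pole_bound_def]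
  obtain p c0 c1 c2 c3 where p: "e + f + n0 + n1 + n2 + n3 + n4 + n5 = p" "row_bounds p M c0 c1 c2 c3"
    using hexagon_row[OF h] by blast
  note row = row_boundsD[OF p(2)]
  from hexagonD(2,3)[OF h] consider "e = 0" "f = 0" | "e = 0" "f = 1" | "e = 1" "f = 0" | "e = 1" "f = 1"
    by blast
  then show "t < M"
  proof cases
    case 1
    have c: "central n0 \<le> c0"
      using z 1 p(1) by (intro row; simp)+
    show ?thesis using N z 1 c row(5,11) by simp
  next
    case 2
    have c: "central n0 \<le> c1"
      using z 2 p(1) by (intro row; simp)+
    show ?thesis using N z 2 c row(6) by simp
  next
    case 3
    have c: "central n0 \<le> c0"
      using z 3 p(1) by (intro row; simp)+
    show ?thesis using N z 3 c row(5,11) by simp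
  next
    case 4
    have c: "central n0 \<le> c2"
      using z 4 p(1) by (intro row; simp)+
    show ?thesis using N z 4 c row(6,10) by simp
  qed
qed

lemma hexagon_01:
  assumes h: "hexagon M t e f a b n0 n1 n2 n3 n4 n5 N0 N1 N2 N3 N4 N5"
  shows "n0 \<noteq> 0 \<and> n1 \<noteq> 0 \<and> n2 = 0 \<and> n3 = 0 \<and> n4 = 0 \<and> n5 = 0 \<longrightarrow> t < M"
proof
  assume z: "n0 \<noteq> 0 \<and> n1 \<noteq> 0 \<and> n2 = 0 \<and> n3 = 0 \<and> n4 = 0 \<and> n5 = 0"
  note N = hexagonD(1,5-)[OF h, unfolded node_bound_def pole_bound_def]
  obtain p c0 c1 c2 c3 where p: "e + f + n0 + n1 + n2 + n3 + n4 + n5 = p" "row_bounds p M c0 c1 c2 c3"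
    using hexagon_row[OF h] by blast
  note row = row_boundsD[OF p(2)]
  from hexagonD(2,3)[OF h] consider "e = 0" "f = 0" | "e = 0" "f = 1" | "e = 1" "f = 0" | "e = 1" "f = 1"
    by blast
  then show "t < M"
  proof cases
    case 1
    \<comment> \<open>The extremal configuration: all layers except \<open>N0\<close> and
      \<open>N1\<close> vanish, and central coefficients alone would not do. Only here is the bound
      on two neighbouring layers invoked; the optimal construction has exactly these types.\<close>
    show ?thesis using N z 1 hexagonD(4)[OF h] by simp
  next
    case 2
    have c: "central (n0 + n1) \<le> c1" "central n0 \<le> c2"
      using z 2 p(1) by (intro row; simp)+
    show ?thesis using N z 2 c row(6,10) by simp
  next
    case 3
    have c: "central (n0 + n1) \<le> c1" "central n1 \<le> c2"
      using z 3 p(1) by (intro row; simp)+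
    show ?thesis using N z 3 c row(6,10) by simp
  next
    case 4
    have c: "central (n0 + n1) \<le> c2" "central n0 \<le> c3" "central n1 \<le> c3"
      using z 4 p(1) by (intro row; simp)+
    show ?thesis using N z 4 c row(7,8,9) by simp
  qed
qed

lemma hexagon_02:
  assumes h: "hexagon M t e f a b n0 n1 n2 n3 n4 n5 N0 N1 N2 N3 N4 N5"
  shows "n0 \<noteq> 0 \<and> n1 = 0 \<and> n2 \<noteq> 0 \<and> n3 = 0 \<and> n4 = 0 \<and> n5 = 0 \<longrightarrow> t < M"
proof
  assume z: "n0 \<noteq> 0 \<and> n1 = 0 \<and> n2 \<noteq> 0 \<and> n3 = 0 \<and> n4 = 0 \<and> n5 = 0"
  note N = hexagonD(1,5-)[OF h, unfolded node_bound_def pole_bound_def]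
  obtain p c0 c1 c2 c3 where p: "e + f + n0 + n1 + n2 + n3 + n4 + n5 = p" "row_bounds p M c0 c1 c2 c3"
    using hexagon_row[OF h] by blast
  note row = row_boundsD[OF p(2)]
  from hexagonD(2,3)[OF h] consider "e = 0" "f = 0" | "e = 0" "f = 1" | "e = 1" "f = 0" | "e = 1" "f = 1"
    by blast
  then show "t < M"
  proof cases
    case 1
    have c: "central (n0 + n2) \<le> c0" "central n0 \<le> c1" "central n2 \<le> c1" using z 1 p(1) by (intro row; simp)+
    \<comment> \<open>A count of 1 has central coefficient 1; if both counts are at least 2, both
      coefficients drop from \<open>c1\<close> to \<open>c2\<close>.\<close>
    consider "n0 = 1" | "n2 = 1" | "2 \<le> n0" "2 \<le> n2" using z by linarith
    then show ?thesis
    proof cases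
      case 3
      then have "central n0 \<le> c2" "central n2 \<le> c2" using 1 p(1) by (intro row; simp)+
      then show ?thesis using N z \<open>e = 0\<close> \<open>f = 0\<close> c row(7) by simp
    qed (use N z 1 c row(5,11) in simp)+
  next
    case 2
    have c: "central (n0 + n2) \<le> c1" "central n0 \<le> c2" "central n2 \<le> c2"
      using z 2 p(1) by (intro row; simp)+
    show ?thesis using N z 2 c row(6,10) by simp
  next
    case 3
    have c: "central (n0 + n2) \<le> c1" "central n0 \<le> c2" "central n2 \<le> c2"
      using z 3 p(1) by (intro row; simp)+
    show ?thesis using N z 3 c row(6,10) by simp
  next
    case 4
    have c: "central (n0 + n2) \<le> c2" "central n0 \<le> c3" "central n2 \<le> c3"
      using z 4 p(1) by (intro row; simp)+
    show ?thesis using N z 4 c row(6,9,10) by simp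
  qed
qed

lemma hexagon_03:
  assumes h: "hexagon M t e f a b n0 n1 n2 n3 n4 n5 N0 N1 N2 N3 N4 N5"
  shows "n0 \<noteq> 0 \<and> n1 = 0 \<and> n2 = 0 \<and> n3 \<noteq> 0 \<and> n4 = 0 \<and> n5 = 0 \<longrightarrow> t < M"
proof
  assume z: "n0 \<noteq> 0 \<and> n1 = 0 \<and> n2 = 0 \<and> n3 \<noteq> 0 \<and> n4 = 0 \<and> n5 = 0"
  note N = hexagonD(1,5-)[OF h, unfolded node_bound_def pole_bound_def]
  obtain p c0 c1 c2 c3 where p: "e + f + n0 + n1 + n2 + n3 + n4 + n5 = p" "row_bounds p M c0 c1 c2 c3"
    using hexagon_row[OF h] by blast
  note row = row_boundsD[OF p(2)]
  have t: "t \<le> 2 * central n0 + 2 * central n3 + 2" using N z by simp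
  have c: "central n0 \<le> c1" "central n3 \<le> c1" using z p(1) by (intro row; simp)+
  \<comment> \<open>If both counts are at least 2, one coefficient is at most \<open>c2\<close> and
    the other at most \<open>c3\<close>: either \<open>n0\<close> is at least 3, or
    \<open>n0 = 2 <= p - 3\<close>.\<close>
  consider "n0 = 1" | "n3 = 1" | "2 \<le> n0" "2 \<le> n3" "3 \<le> n0" | "2 \<le> n0" "2 \<le> n3" "n0 = 2"
    using z by linarith
  then show "t < M"
  proof cases
    case 3
    then have "central n0 \<le> c2" "central n3 \<le> c3" using p(1) by (intro row; simp)+
    then show ?thesis using t row(7,8,9) by simp
  next
    case 4
    then have "central n0 \<le> c3" "central n3 \<le> c2" using p(1) row(12) hexagonD(2,3)[OF h] z by (intro row; auto)+
    then show ?thesis using t row(7,8,9) by simp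
  qed (use t c row(6,9-11) in simp)+
qed

lemma hexagon_012:
  assumes h: "hexagon M t e f a b n0 n1 n2 n3 n4 n5 N0 N1 N2 N3 N4 N5"
  shows "n0 \<noteq> 0 \<and> n1 \<noteq> 0 \<and> n2 \<noteq> 0 \<and> n3 = 0 \<and> n4 = 0 \<and> n5 = 0 \<longrightarrow> t < M"
proof
  assume z: "n0 \<noteq> 0 \<and> n1 \<noteq> 0 \<and> n2 \<noteq> 0 \<and> n3 = 0 \<and> n4 = 0 \<and> n5 = 0"
  note N = hexagonD(1,5-)[OF h, unfolded node_bound_def pole_bound_def]
  obtain p c0 c1 c2 c3 where p: "e + f + n0 + n1 + n2 + n3 + n4 + n5 = p" "row_bounds p M c0 c1 c2 c3"
    using hexagon_row[OF h] by blast
  note row = row_boundsD[OF p(2)]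
  from hexagonD(2,3)[OF h] consider "e = 0" "f = 0" | "e = 0" "f = 1" | "e = 1" "f = 0" | "e = 1" "f = 1"
    by blast
  then show "t < M"
  proof cases
    case 1
    have c: "central (n0 + n1 + n2) \<le> c0" "central (n0 + n1) \<le> c1" "central (n1 + n2) \<le> c1"
      using z 1 p(1) by (intro row; simp)+
    \<comment> \<open>A count of 1 at node 0 or 2 activates a singleton clause of
      \<open>node_bound\<close>, which replaces the bound on \<open>N0\<close> or \<open>N2\<close>
      by \<open>central n1\<close>. Without it the estimate \<open>c1\<close> for that layer would
      be too weak.\<close>
    consider "n0 = 1" "n2 = 1" | "n0 = 1" "2 \<le> n2" | "2 \<le> n0" "n2 = 1" | "2 \<le> n0" "2 \<le> n2" using z by linarith
    then show ?thesis
    proof cases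
      case 1
      then have "central n1 \<le> c2" using \<open>e = 0\<close> \<open>f = 0\<close> p(1) by (intro row) simp
      then show ?thesis using N z 1 \<open>e = 0\<close> \<open>f = 0\<close> c row(7) by simp
    next
      case 2
      then have "central n1 \<le> c3" using p(1) by (intro row) simp
      then show ?thesis using N z 2 \<open>e = 0\<close> \<open>f = 0\<close> c row(5) by simp
    next
      case 3
      then have "central n1 \<le> c3" using p(1) by (intro row) simp
      then show ?thesis using N z 3 \<open>e = 0\<close> \<open>f = 0\<close> c row(5) by simp
    next
      case 4
      then have "central (n0 + n1) \<le> c2" "central (n1 + n2) \<le> c2" using p(1) by (intro row; simp)+
      then show ?thesis using N z 4 \<open>e = 0\<close> \<open>f = 0\<close> c row(7) by simp
    qed
  next
    case 2
    have c: "central (n0 + n1 + n2) \<le> c1" "central (n0 + n1) \<le> c2" "central (n1 + n2) \<le> c2"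
      using z 2 p(1) by (intro row; simp)+
    show ?thesis using N z 2 c row(6,10) by simp
  next
    case 3
    have c: "central (n0 + n1 + n2) \<le> c1" "central (n0 + n1) \<le> c2" "central (n1 + n2) \<le> c2"
      using z 3 p(1) by (intro row; simp)+
    show ?thesis using N z 3 c row(6,10) by simp
  next
    case 4
    have c: "central (n0 + n1 + n2) \<le> c1" "central (n0 + n1) \<le> c2" "central (n1 + n2) \<le> c2"
      using z 4 p(1) by (intro row; simp)+
    show ?thesis using N z 4 c row(6,10) by simp
  qed
qed

lemma hexagon_013:
  assumes h: "hexagon M t e f a b n0 n1 n2 n3 n4 n5 N0 N1 N2 N3 N4 N5"
  shows "n0 \<noteq> 0 \<and> n1 \<noteq> 0 \<and> n2 = 0 \<and> n3 \<noteq> 0 \<and> n4 = 0 \<and> n5 = 0 \<longrightarrow> t < M"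
proof
  assume z: "n0 \<noteq> 0 \<and> n1 \<noteq> 0 \<and> n2 = 0 \<and> n3 \<noteq> 0 \<and> n4 = 0 \<and> n5 = 0"
  note N = hexagonD(1,5-)[OF h, unfolded node_bound_def pole_bound_def]
  obtain p c0 c1 c2 c3 where p: "e + f + n0 + n1 + n2 + n3 + n4 + n5 = p" "row_bounds p M c0 c1 c2 c3"
    using hexagon_row[OF h] by blast
  note row = row_boundsD[OF p(2)]
  have c: "central (n0 + n1) \<le> c1" "central (n1 + n3) \<le> c1" "central n0 \<le> c2"
    using z p(1) by (intro row; simp)+
  show "t < M" using N z c row(6,10) by simp
qed

lemma hexagon_024:
  assumes h: "hexagon M t e f a b n0 n1 n2 n3 n4 n5 N0 N1 N2 N3 N4 N5"
  shows "n0 \<noteq> 0 \<and> n1 = 0 \<and> n2 \<noteq> 0 \<and> n3 = 0 \<and> n4 \<noteq> 0 \<and> n5 = 0 \<longrightarrow> t < M"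
proof
  assume z: "n0 \<noteq> 0 \<and> n1 = 0 \<and> n2 \<noteq> 0 \<and> n3 = 0 \<and> n4 \<noteq> 0 \<and> n5 = 0"
  note N = hexagonD(1,5-)[OF h, unfolded node_bound_def pole_bound_def]
  obtain p c0 c1 c2 c3 where p: "e + f + n0 + n1 + n2 + n3 + n4 + n5 = p" "row_bounds p M c0 c1 c2 c3"
    using hexagon_row[OF h] by blast
  note row = row_boundsD[OF p(2)]
  have c: "central n0 \<le> c2" "central n2 \<le> c2" "central n4 \<le> c2"
    using z p(1) by (intro row; simp)+
  show "t < M" using N z c row(6,10) by simp
qed

text \<open>Four occupied nodes annihilate the four opposite layers. Two layers of size at most
  \<open>c1\<close> and the two poles remain, so here and in the next two lemmas the other nodes may
  be left unrestricted.\<close>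

lemma hexagon_0123:
  assumes h: "hexagon M t e f a b n0 n1 n2 n3 n4 n5 N0 N1 N2 N3 N4 N5"
  shows "n0 \<noteq> 0 \<and> n1 \<noteq> 0 \<and> n2 \<noteq> 0 \<and> n3 \<noteq> 0 \<longrightarrow> t < M"
proof
  assume z: "n0 \<noteq> 0 \<and> n1 \<noteq> 0 \<and> n2 \<noteq> 0 \<and> n3 \<noteq> 0"
  note N = hexagonD(1,5-)[OF h, unfolded node_bound_def pole_bound_def]
  obtain p c0 c1 c2 c3 where p: "e + f + n0 + n1 + n2 + n3 + n4 + n5 = p" "row_bounds p M c0 c1 c2 c3"
    using hexagon_row[OF h] by blast
  note row = row_boundsD[OF p(2)]
  have c: "central (n0 + n1 + n2) \<le> c1" "central (n1 + n2 + n3) \<le> c1"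
    using z p(1) by (intro row; simp)+
  show "t < M" using N z c row(6,9,10,11) by simp
qed

lemma hexagon_0124:
  assumes h: "hexagon M t e f a b n0 n1 n2 n3 n4 n5 N0 N1 N2 N3 N4 N5"
  shows "n0 \<noteq> 0 \<and> n1 \<noteq> 0 \<and> n2 \<noteq> 0 \<and> n4 \<noteq> 0 \<longrightarrow> t < M"
proof
  assume z: "n0 \<noteq> 0 \<and> n1 \<noteq> 0 \<and> n2 \<noteq> 0 \<and> n4 \<noteq> 0"
  note N = hexagonD(1,5-)[OF h, unfolded node_bound_def pole_bound_def]
  obtain p c0 c1 c2 c3 where p: "e + f + n0 + n1 + n2 + n3 + n4 + n5 = p" "row_bounds p M c0 c1 c2 c3"
    using hexagon_row[OF h] by blast
  note row = row_boundsD[OF p(2)]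
  have c: "central (n5 + n0 + n1) \<le> c1" "central (n1 + n2 + n3) \<le> c1"
    using z p(1) by (intro row; simp)+
  show "t < M" using N z c row(6,9,10,11) by simp
qed

lemma hexagon_0134:
  assumes h: "hexagon M t e f a b n0 n1 n2 n3 n4 n5 N0 N1 N2 N3 N4 N5"
  shows "n0 \<noteq> 0 \<and> n1 \<noteq> 0 \<and> n3 \<noteq> 0 \<and> n4 \<noteq> 0 \<longrightarrow> t < M"
proof
  assume z: "n0 \<noteq> 0 \<and> n1 \<noteq> 0 \<and> n3 \<noteq> 0 \<and> n4 \<noteq> 0"
  note N = hexagonD(1,5-)[OF h, unfolded node_bound_def pole_bound_def]
  obtain p c0 c1 c2 c3 where p: "e + f + n0 + n1 + n2 + n3 + n4 + n5 = p" "row_bounds p M c0 c1 c2 c3"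
    using hexagon_row[OF h] by blast
  note row = row_boundsD[OF p(2)]
  have c: "central (n1 + n2 + n3) \<le> c1" "central (n4 + n5 + n0) \<le> c1"
    using z p(1) by (intro row; simp)+
  show "t < M" using N z c row(6,9,10,11) by simp
qed

text \<open>Up to rotation and reflection, a set of at most three nodes is one of eight, and every
  larger set contains one of three sets of four nodes. The twelve symmetric images of
  \<open>h\<close> thus reduce the claim to propositional reasoning.\<close>

lemma hexagon_less:
  assumes h: "hexagon M t e f a b n0 n1 n2 n3 n4 n5 N0 N1 N2 N3 N4 N5"
  shows "t < M"
proof -
  note r = hexagon_rotate
  note h1 = r[OF h] note h2 = r[OF h1] note h3 = r[OF h2] note h4 = r[OF h3] note h5 = r[OF h4]
  note H = h h1 h2 h3 h4 h5
  note H = H H[THEN hexagon_reflect]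
  from H[THEN hexagon_none] H[THEN hexagon_0] H[THEN hexagon_01] H[THEN hexagon_02] H[THEN hexagon_03] H[THEN hexagon_012] H[THEN hexagon_013] H[THEN hexagon_024] H[THEN hexagon_0123] H[THEN hexagon_0124] H[THEN hexagon_0134]
  show ?thesis by argo
qed

section \<open>Orientations of diameter 2 as set families\<close>

text \<open>Outside \<open>R\<close> all members agree, so the traces on \<open>R\<close> are
  distinct and again form an antichain.\<close>

lemma card_le_central:
  assumes "finite R" and antichain: "\<And>T T'. T \<in> G \<Longrightarrow> T' \<in> G \<Longrightarrow> T \<subseteq> T' \<Longrightarrow> T = T'"
    and fixed: "\<And>T. T \<in> G \<Longrightarrow> T - R = B"
  shows "card G \<le> central (card R)"
proof -
  have sub: "T \<subseteq> T'" if "T \<in> G" "T' \<in> G" "T \<inter> R \<subseteq> T' \<inter> R" for T T'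
    using fixed[OF that(1)] fixed[OF that(2)] that(3) by blast
  have "inj_on (\<lambda>T. T \<inter> R) G"
    by (rule inj_onI) (metis sub order_refl subset_antisym)
  then have "card G = card ((\<lambda>T. T \<inter> R) ` G)" by (simp add: card_image)
  also have "\<dots> \<le> card R choose (card R div 2)"
  proof (rule sperner(1)[OF assms(1)])
    show "A = B" if AB: "A \<in> (\<lambda>T. T \<inter> R) ` G" "B \<in> (\<lambda>T. T \<inter> R) ` G" "A \<subseteq> B" for A B
    proof -
      obtain T T' where "T \<in> G" "T' \<in> G" "A = T \<inter> R" "B = T' \<inter> R"
        using AB(1,2) by auto
      then show ?thesis using sub[of T T'] antichain[of T T'] AB(3) by simp
    qed
  qed auto
  finally show ?thesis by (simp add: central_def)
qed

text \<open>In an orientation of diameter 2, \<open>A i\<close> is the set of out-neighbours in the part \<open>Y\<close>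
  of the vertex \<open>i\<close> of the part of size 3, and \<open>(S, T) \<in> F\<close> records the out-neighbours in these
  two parts of a vertex of the remaining part.\<close>

locale diameter_two_family =
  fixes Y :: "'b set" and A :: "nat \<Rightarrow> 'b set" and F :: "(nat set \<times> 'b set) set"
  assumes finite_Y: "finite Y" and A_subset: "\<And>i. A i \<subseteq> Y"
    and F_subset: "F \<subseteq> Pow {0, 1, 2} \<times> Pow Y"
    and antichain: "\<And>S T S' T'. (S, T) \<in> F \<Longrightarrow> (S', T') \<in> F \<Longrightarrow> S \<subseteq> S' \<Longrightarrow> T \<subseteq> T' \<Longrightarrow> S = S' \<and> T = T'"
    and not_above: "\<And>S T i. (S, T) \<in> F \<Longrightarrow> i \<in> S \<Longrightarrow> \<not> A i \<subseteq> T"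
    and not_below: "\<And>S T i. (S, T) \<in> F \<Longrightarrow> i \<in> {0, 1, 2} - S \<Longrightarrow> \<not> T \<subseteq> A i"
    and covered: "\<And>S T y. (S, T) \<in> F \<Longrightarrow> y \<in> Y - T \<Longrightarrow> \<exists>i\<in>S. y \<in> A i"
    and avoided: "\<And>S T y. (S, T) \<in> F \<Longrightarrow> y \<in> T \<Longrightarrow> \<exists>i\<in>{0, 1, 2} - S. y \<notin> A i"
    and none_le_1: "card {y \<in> Y. \<forall>i\<in>{0, 1, 2}. y \<notin> A i} \<le> 1"
    and all_le_1: "card {y \<in> Y. \<forall>i\<in>{0, 1, 2}. y \<in> A i} \<le> 1"
begin

definition layer :: "nat set \<Rightarrow> 'b set set" where
  "layer S = {T. (S, T) \<in> F}"

text \<open>\<open>covered\<close> forces \<open>y\<close> into \<open>T\<close> if no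
  \<open>i\<close> in \<open>S\<close> has \<open>y\<close> in \<open>A i\<close>;
  \<open>avoided\<close> forces \<open>y\<close> out if every other \<open>i\<close> has it. The
  remaining vertices are free.\<close>

definition free :: "nat set \<Rightarrow> 'b set" where
  "free S = {y \<in> Y. (\<exists>i\<in>S. y \<in> A i) \<and> (\<exists>i\<in>{0, 1, 2} - S. y \<notin> A i)}"

lemma layer_antichain: "T \<in> layer S \<Longrightarrow> T' \<in> layer S \<Longrightarrow> T \<subseteq> T' \<Longrightarrow> T = T'"
  using antichain unfolding layer_def by blast

lemma layer_outside_free:
  assumes "T \<in> layer S"
  shows "T - free S = {y \<in> Y. \<forall>i\<in>S. y \<notin> A i}"
  using assms covered[of S T] avoided[of S T] F_subset unfolding layer_def free_def by blast

lemma finite_free: "finite (free S)"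
  unfolding free_def using finite_Y by simp

lemma card_layer_le: "card (layer S) \<le> central (card (free S))"
  by (rule card_le_central[OF finite_free layer_antichain layer_outside_free])

text \<open>A vertex whose type is the complement of \<open>S\<close> would be forced both into and
  out of \<open>T\<close>. The other two claims are \<open>not_above\<close> and
  \<open>not_below\<close> for extreme \<open>A i\<close>.\<close>

lemma layer_nonempty:
  assumes "layer S \<noteq> {}"
  shows "\<not> (\<exists>y\<in>Y. (\<forall>i\<in>S. y \<notin> A i) \<and> (\<forall>i\<in>{0, 1, 2} - S. y \<in> A i))"
    and "i \<in> S \<Longrightarrow> A i \<noteq> {}" and "i \<in> {0, 1, 2} - S \<Longrightarrow> A i \<noteq> Y"
proof -
  obtain T where T: "(S, T) \<in> F" using assms unfolding layer_def by blast
  show "\<not> (\<exists>y\<in>Y. (\<forall>i\<in>S. y \<notin> A i) \<and> (\<forall>i\<in>{0, 1, 2} - S. y \<in> A i))"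
    using covered[OF T] avoided[OF T] by blast
  show "A i \<noteq> {}" if "i \<in> S" using not_above[OF T that] by blast
  show "A i \<noteq> Y" if "i \<in> {0, 1, 2} - S" using not_below[OF T that] T F_subset by blast
qed

text \<open>If \<open>A i = {y}\<close>, then \<open>not_above\<close> keeps \<open>y\<close> out of
  \<open>T\<close>; if \<open>Y - A i = {y}\<close>, then \<open>not_below\<close> puts it in.
  Either way \<open>y\<close> is no longer free.\<close>

lemma card_layer_le_singleton:
  assumes "i \<in> S \<and> A i = {y} \<or> i \<in> {0, 1, 2} - S \<and> Y - A i = {y}"
  shows "card (layer S) \<le> central (card (free S - {y}))"
  using assms
proof
  assume i: "i \<in> S \<and> A i = {y}"
  have outside: "T - (free S - {y}) = {y \<in> Y. \<forall>i\<in>S. y \<notin> A i}" if "T \<in> layer S" for T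
  proof -
    have "y \<notin> T" using not_above[of S T i] i that unfolding layer_def by auto
    then show ?thesis using layer_outside_free[OF that] by auto
  qed
  show ?thesis
    by (rule card_le_central[OF finite_Diff[OF finite_free] layer_antichain outside])
next
  assume i: "i \<in> {0, 1, 2} - S \<and> Y - A i = {y}"
  have outside: "T - (free S - {y}) = insert y {y \<in> Y. \<forall>i\<in>S. y \<notin> A i}" if "T \<in> layer S" for T
  proof -
    have "\<not> T \<subseteq> A i" "T \<subseteq> Y"
      using not_below[of S T i] i that F_subset unfolding layer_def by auto
    then have "y \<in> T" using i by (metis DiffI singletonD subsetD subsetI)
    then show ?thesis using layer_outside_free[OF that] by auto
  qed
  show ?thesis
    by (rule card_le_central[OF finite_Diff[OF finite_free] layer_antichain outside])
qed

text \<open>The two layers form an antichain in the subsets of \<open>insert None (Some ` Y)\<close>, and this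
  antichain misses every maximal chain through \<open>A i\<close> and \<open>insert None (A i)\<close>.\<close>

lemma card_two_layers_less:
  assumes i: "i \<in> {0, 1, 2}" "i \<notin> S"
  shows "card (layer S) + card (layer (insert i S)) < central (card Y + 1)"
proof -
  \<comment> \<open>\<open>None\<close> plays the role of the vertex \<open>i\<close> and is the
    additional element that turns \<open>card Y\<close> into \<open>card Y + 1\<close>.\<close>
  define U where "U = insert None (Some ` Y)"
  define G where "G = (\<lambda>T. Some ` T) ` layer S"
  define H where "H = (\<lambda>T. insert None (Some ` T)) ` layer (insert i S)"
  have inj: "Some ` T \<subseteq> Some ` T' \<longleftrightarrow> T \<subseteq> T'" for T T' :: "'b set"
    by (metis inj_Some inj_image_subset_iff)
  have inj': "insert None (Some ` T) \<subseteq> insert None (Some ` T') \<longleftrightarrow> T \<subseteq> T'" for T T' :: "'b set"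
    by auto
  have finU: "finite U" and cardU: "card U = card Y + 1"
    using finite_Y by (auto simp: U_def card_image card_insert_if)
  have sub: "layer S \<subseteq> Pow Y" for S
    using F_subset unfolding layer_def by blast
  have fin: "finite (layer S)" for S
    using finite_subset[OF sub] finite_Y by simp
  have "card G = card (layer S)" "card H = card (layer (insert i S))"
    unfolding G_def H_def by (intro card_image inj_onI; metis inj inj' order_antisym order_refl)+
  moreover have "card (G \<union> H) = card G + card H"
    using fin by (intro card_Un_disjoint) (auto simp: G_def H_def)
  moreover have "card (G \<union> H) < card U choose (card U div 2)"
  proof -
    obtain ys zs where yz: "set ys = A i" "distinct ys" "set zs = Y - A i" "distinct zs"
      by (metis A_subset finite_Y finite_Diff finite_distinct_list finite_subset)
    show ?thesis
    proof (rule sperner(2)[OF finU])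
      show "G \<union> H \<subseteq> Pow U"
        using sub unfolding G_def H_def U_def by blast
      show "map Some ys @ None # map Some zs \<in> permutations_of_set U"
        using yz A_subset[of i] by (auto simp: permutations_of_set_def U_def distinct_map)
      show "P = Q" if PQ: "P \<in> G \<union> H" "Q \<in> G \<union> H" "P \<subseteq> Q" for P Q
      proof -
        have *: "Some ` T \<subseteq> insert None (Some ` T') \<longleftrightarrow> T \<subseteq> T'" for T T' :: "'b set" by auto
        have **: "\<not> T \<subseteq> T'" if "T \<in> layer S" "T' \<in> layer (insert i S)" for T T'
          using that antichain[of S T "insert i S" T'] i(2) unfolding layer_def by blast
        consider T T' where "T \<in> layer S" "P = Some ` T" "T' \<in> layer S" "Q = Some ` T'"
          | T T' where "T \<in> layer S" "P = Some ` T" "T' \<in> layer (insert i S)" "Q = insert None (Some ` T')"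
          | T where "P = insert None (Some ` T)" "None \<notin> Q"
          | T T' where "T \<in> layer (insert i S)" "P = insert None (Some ` T)"
              "T' \<in> layer (insert i S)" "Q = insert None (Some ` T')"
          using PQ(1,2) unfolding G_def H_def by blast
        then show ?thesis
        proof cases
          case 1
          then show ?thesis using PQ(3) inj layer_antichain by metis
        next
          case 2
          then show ?thesis using PQ(3) * ** by metis
        next
          case 3
          then show ?thesis using PQ(3) by blast
        next
          case 4
          then show ?thesis using PQ(3) inj' layer_antichain by metis
        qed
      qed
      show "set (take k (map Some ys @ None # map Some zs)) \<notin> G \<union> H" for k
      \<comment> \<open>Prefixes up to \<open>length ys\<close> lie inside \<open>A i\<close> and
        are excluded by \<open>not_below\<close>; longer ones contain \<open>None\<close> and all of
        \<open>A i\<close> and are excluded by \<open>not_above\<close>.\<close>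
      proof (cases "k \<le> length ys")
        case True
        then have eq: "set (take k (map Some ys @ None # map Some zs)) = Some ` set (take k ys)"
          by (simp add: take_map)
        have "set (take k ys) \<subseteq> A i" using yz set_take_subset by metis
        then have "set (take k ys) \<notin> layer S"
          using not_below[of S _ i] i unfolding layer_def by blast
        then show ?thesis unfolding eq G_def H_def by (auto simp: inj_image_eq_iff)
      next
        case False
        then obtain l where "k - length ys = Suc l" by (metis diff_is_0_eq not0_implies_Suc)
        then have eq: "set (take k (map Some ys @ None # map Some zs)) =
            insert None (Some ` (A i \<union> set (take l zs)))"
          using False yz by (auto simp: take_map)
        have "A i \<union> set (take l zs) \<notin> layer (insert i S)"
          using not_above[of "insert i S" _ i] unfolding layer_def by blast
        moreover have "insert None (Some ` T) = insert None (Some ` T') \<longleftrightarrow> T = T'" for T T' :: "'b set"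
          using inj'[of T T'] inj'[of T' T] by blast
        moreover have "insert None (Some ` T) \<noteq> Some ` T'" for T T' :: "'b set"
          by blast
        ultimately show ?thesis unfolding eq G_def H_def Un_iff image_iff
          by metis
      qed
    qed
  qed
  ultimately show ?thesis by (simp add: central_def cardU)
qed

end

lemma card_split:
  "finite Y \<Longrightarrow> card {y \<in> Y. P y} = card {y \<in> Y. P y \<and> R y} + card {y \<in> Y. P y \<and> \<not> R y}"
  by (subst card_Un_disjoint[symmetric]) (auto intro: arg_cong[of _ _ card])

lemma sum_Pow_insert:
  assumes "finite B" "a \<notin> B"
  shows "(\<Sum>S\<in>Pow (insert a B). f S) = (\<Sum>S\<in>Pow B. f S) + (\<Sum>S\<in>Pow B. f (insert a S))"
proof -
  have "inj_on (insert a) (Pow B)"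
    using assms(2) by (auto intro!: inj_onI simp: insert_ident)
  moreover have "Pow B \<inter> insert a ` Pow B = {}" using assms(2) by auto
  ultimately show ?thesis
    using assms(1) by (simp add: Pow_insert sum.union_disjoint sum.reindex)
qed

context diameter_two_family
begin

section \<open>Counting vertices by type\<close>

definition type_count :: "nat set \<Rightarrow> nat" where
  "type_count W = card {y \<in> Y. \<forall>i\<in>{0, 1, 2}. y \<in> A i \<longleftrightarrow> i \<in> W}"

text \<open>An arbitrary naming of 0, 1, 2 lets one lemma serve three rotations of the
  hexagon.\<close>

definition triple :: "nat \<Rightarrow> nat \<Rightarrow> nat \<Rightarrow> bool" where
  "triple i j k \<longleftrightarrow> {0, 1, 2} = {i, j, k} \<and> i \<noteq> j \<and> j \<noteq> k \<and> k \<noteq> i"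

text \<open>Splitting by the three memberships turns the size of any set defined from the
  \<open>A i\<close> into a sum of type counts, which simplification evaluates for a concrete
  \<open>Q\<close>.\<close>

lemma card_eq_counts:
  assumes "triple i j k"
  shows "card {y \<in> Y. Q (y \<in> A i) (y \<in> A j) (y \<in> A k)} =
    (if Q True True True then type_count {0, 1, 2} else 0) + (if Q True True False then type_count {i, j} else 0) +
    (if Q True False True then type_count {k, i} else 0) + (if Q True False False then type_count {i} else 0) +
    (if Q False True True then type_count {j, k} else 0) + (if Q False True False then type_count {j} else 0) +
    (if Q False False True then type_count {k} else 0) + (if Q False False False then type_count {} else 0)"
proof -
  let ?Q = "\<lambda>y. Q (y \<in> A i) (y \<in> A j) (y \<in> A k)"
  have t: "{0, 1, 2} = {i, j, k}" "i \<noteq> j" "j \<noteq> k" "k \<noteq> i" using assms by (auto simp: triple_def)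
  have c: "card {y \<in> Y. ((?Q y \<and> (y \<in> A i) = a) \<and> (y \<in> A j) = b) \<and> (y \<in> A k) = c} =
    (if Q a b c then type_count {l \<in> {i, j, k}. (l = i \<longrightarrow> a) \<and> (l = j \<longrightarrow> b) \<and> (l = k \<longrightarrow> c)} else 0)" for a b c
  proof (cases "Q a b c")
    case True
    then show ?thesis
      using t(2-) unfolding type_count_def t(1) by (auto intro!: arg_cong[of _ _ card])
  next
    case False
    then have "{y \<in> Y. ((?Q y \<and> (y \<in> A i) = a) \<and> (y \<in> A j) = b) \<and> (y \<in> A k) = c} = {}"
      by blast
    then have "card {y \<in> Y. ((?Q y \<and> (y \<in> A i) = a) \<and> (y \<in> A j) = b) \<and> (y \<in> A k) = c} = 0"
      by (simp only: card.empty)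
    with False show ?thesis by (simp only: if_False)
  qed
  have s: "{l \<in> {i, j, k}. (l = i \<longrightarrow> a) \<and> (l = j \<longrightarrow> b) \<and> (l = k \<longrightarrow> c)} =
    (if a then {i} else {}) \<union> (if b then {j} else {}) \<union> (if c then {k} else {})" for a b c
    using t(2-) by (cases a; cases b; cases c) auto
  note split = card_split[OF finite_Y]
  have "card {y \<in> Y. ?Q y} = card {y \<in> Y. ?Q y \<and> y \<in> A i} + card {y \<in> Y. ?Q y \<and> y \<notin> A i}"
    by (rule split)
  moreover have "card {y \<in> Y. ?Q y \<and> (y \<in> A i) = a} =
      card {y \<in> Y. (?Q y \<and> (y \<in> A i) = a) \<and> y \<in> A j} + card {y \<in> Y. (?Q y \<and> (y \<in> A i) = a) \<and> y \<notin> A j}" for a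
    by (rule split)
  note this[of True] this[of False]
  moreover have "card {y \<in> Y. (?Q y \<and> (y \<in> A i) = a) \<and> (y \<in> A j) = b} =
      card {y \<in> Y. ((?Q y \<and> (y \<in> A i) = a) \<and> (y \<in> A j) = b) \<and> y \<in> A k} +
      card {y \<in> Y. ((?Q y \<and> (y \<in> A i) = a) \<and> (y \<in> A j) = b) \<and> y \<notin> A k}" for a b
    by (rule split)
  note this[of True True] this[of True False] this[of False True] this[of False False]
  ultimately show ?thesis
    using c[of True True True] c[of True True False] c[of True False True] c[of True False False]
      c[of False True True] c[of False True False] c[of False False True] c[of False False False]
    unfolding s t(1) by (simp add: insert_commute)
qed

lemma type_count_eq_0: "type_count W = 0 \<longleftrightarrow> \<not> (\<exists>y\<in>Y. \<forall>i\<in>{0, 1, 2}. y \<in> A i \<longleftrightarrow> i \<in> W)"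
  unfolding type_count_def using finite_Y by auto

lemma card_A: "triple i j k \<Longrightarrow> card (A i) = type_count {0, 1, 2} + type_count {k, i} + type_count {i} + type_count {i, j}"
  using card_eq_counts[of i j k "\<lambda>a b c. a"] A_subset[of i] by (simp add: Collect_conj_eq Int_absorb1)

lemma card_diff_A: "triple i j k \<Longrightarrow> card (Y - A i) = type_count {} + type_count {j} + type_count {j, k} + type_count {k}"
  using card_eq_counts[of i j k "\<lambda>a b c. \<not> a"] by (simp add: set_diff_eq)

lemma triple_rotate: "triple i j k \<Longrightarrow> triple j k i"
  unfolding triple_def by auto

lemma layer_nonempty_card:
  assumes "layer S \<noteq> {}" "i \<in> {0, 1, 2}"
  shows "i \<in> S \<Longrightarrow> 0 < card (A i)" and "i \<notin> S \<Longrightarrow> 0 < card (Y - A i)"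
  using layer_nonempty(2,3)[OF assms(1), of i] assms(2) A_subset[of i] finite_Y finite_subset[of "A i" Y]
  by (auto simp: card_gt_0_iff)

lemma finite_layer: "finite (layer S)"
proof (rule finite_subset)
  show "layer S \<subseteq> Pow Y" using F_subset unfolding layer_def by blast
qed (simp add: finite_Y)

lemma card_layer_le_refined:
  assumes "B \<subseteq> free S" "card B = 1" "i \<in> S \<and> A i = B \<or> i \<in> {0, 1, 2} - S \<and> Y - A i = B"
  shows "card (layer S) \<le> central (card (free S) - 1)"
proof -
  obtain y where "B = {y}" using assms(2) by (meson card_1_singletonE)
  then show ?thesis
    using card_layer_le_singleton[of i S y] assms finite_free by simp
qed

text \<open>The singleton clauses arise because \<open>Y - A j\<close>, respectively
  \<open>Y - A k\<close>, then consists of one vertex of type \<open>{i}\<close>, which is a free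
  vertex.\<close>

lemma node_bound_single:
  assumes t: "triple i j k"
  shows "node_bound (type_count {}) (type_count {0, 1, 2}) (type_count {i}) (type_count {i, j}) (type_count {j}) (type_count {j, k})
    (type_count {k}) (type_count {k, i}) (card (layer {i}))"
proof -
  have t': "{0, 1, 2} = {i, j, k}" "i \<noteq> j" "j \<noteq> k" "k \<noteq> i" using t by (auto simp: triple_def)
  have mem: "i \<in> {0, 1, 2}" "j \<in> {0, 1, 2}" "k \<in> {0, 1, 2}" unfolding t'(1) by simp_all
  have free: "free {i} = {y \<in> Y. y \<in> A i \<and> (y \<notin> A j \<or> y \<notin> A k)}"
    unfolding free_def t'(1) using t'(2-) by auto
  have card_free: "card (free {i}) = type_count {k, i} + type_count {i} + type_count {i, j}"
    unfolding free using card_eq_counts[OF t, of "\<lambda>a b c. a \<and> (\<not> b \<or> \<not> c)"] by simp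
  have avoid_j: "card (Y - A j) = type_count {} + type_count {k} + type_count {k, i} + type_count {i}"
    using card_diff_A[OF triple_rotate[OF t]] by simp
  have avoid_k: "card (Y - A k) = type_count {} + type_count {i} + type_count {i, j} + type_count {j}"
    using card_diff_A[OF triple_rotate[OF triple_rotate[OF t]]] by simp
  have "card (layer {i}) \<le> central (type_count {i, j})" if "type_count {} + type_count {k} + type_count {k, i} = 0" "type_count {i} = 1"
  proof -
    have "Y - A j \<subseteq> free {i}"
      using that(1) t'(2-) type_count_eq_0[of "{}"] type_count_eq_0[of "{k}"] unfolding free t'(1) by auto
    then show ?thesis
      using card_layer_le_refined[of "Y - A j" "{i}" j] that t'(2-) mem by (simp add: avoid_j card_free)
  qed
  moreover have "card (layer {i}) \<le> central (type_count {k, i})" if "type_count {} + type_count {i, j} + type_count {j} = 0" "type_count {i} = 1"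
  proof -
    have "Y - A k \<subseteq> free {i}"
      using that(1) t'(2-) type_count_eq_0[of "{}"] type_count_eq_0[of "{j}"] unfolding free t'(1) by auto
    then show ?thesis
      using card_layer_le_refined[of "Y - A k" "{i}" k] that t'(2-) mem by (simp add: avoid_k card_free)
  qed
  moreover have "type_count {j, k} = 0 \<and> 0 < card (A i) \<and> 0 < card (Y - A j) \<and> 0 < card (Y - A k)"
    if "card (layer {i}) \<noteq> 0"
  proof -
    have ne: "layer {i} \<noteq> {}" using that by auto
    have "type_count {j, k} = 0"
      unfolding type_count_eq_0 using layer_nonempty(1)[OF ne] t'(2-) unfolding t'(1) by auto
    then show ?thesis
      using layer_nonempty_card(1)[OF ne mem(1)] layer_nonempty_card(2)[OF ne mem(2)] layer_nonempty_card(2)[OF ne mem(3)] t'(2-) by simp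
  qed
  ultimately show ?thesis
    using card_layer_le[of "{i}"] unfolding node_bound_def card_free card_A[OF t] avoid_j avoid_k
    by (auto simp: add.commute add.left_commute)
qed

text \<open>The dual under arc reversal: the singletons are now \<open>A i\<close> and
  \<open>A j\<close>, and the poles change places.\<close>

lemma node_bound_pair:
  assumes t: "triple i j k"
  shows "node_bound (type_count {0, 1, 2}) (type_count {}) (type_count {i, j}) (type_count {j}) (type_count {j, k})
    (type_count {k}) (type_count {k, i}) (type_count {i}) (card (layer {i, j}))"
proof -
  have t': "{0, 1, 2} = {i, j, k}" "i \<noteq> j" "j \<noteq> k" "k \<noteq> i" using t by (auto simp: triple_def)
  have mem: "i \<in> {0, 1, 2}" "j \<in> {0, 1, 2}" "k \<in> {0, 1, 2}" unfolding t'(1) by simp_all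
  have free: "free {i, j} = {y \<in> Y. (y \<in> A i \<or> y \<in> A j) \<and> y \<notin> A k}"
    unfolding free_def t'(1) using t'(2-) by auto
  have card_free: "card (free {i, j}) = type_count {i} + type_count {i, j} + type_count {j}"
    unfolding free using card_eq_counts[OF t, of "\<lambda>a b c. (a \<or> b) \<and> \<not> c"] by simp
  have A_j: "card (A j) = type_count {0, 1, 2} + type_count {i, j} + type_count {j} + type_count {j, k}"
    using card_A[OF triple_rotate[OF t]] by simp
  have avoid_k: "card (Y - A k) = type_count {} + type_count {i} + type_count {i, j} + type_count {j}"
    using card_diff_A[OF triple_rotate[OF triple_rotate[OF t]]] by simp
  have "card (layer {i, j}) \<le> central (type_count {j})"
    if "type_count {0, 1, 2} + type_count {k, i} + type_count {i} = 0" "type_count {i, j} = 1"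
  proof -
    have "A i \<subseteq> free {i, j}"
      using that(1) t'(2-) type_count_eq_0[of "{0, 1, 2}"] type_count_eq_0[of "{k, i}"] A_subset[of i]
      unfolding free t'(1) by auto
    then show ?thesis
      using card_layer_le_refined[of "A i" "{i, j}" i] that t'(2-) mem by (simp add: card_A[OF t] card_free)
  qed
  moreover have "card (layer {i, j}) \<le> central (type_count {i})"
    if "type_count {0, 1, 2} + type_count {j} + type_count {j, k} = 0" "type_count {i, j} = 1"
  proof -
    have "A j \<subseteq> free {i, j}"
      using that(1) t'(2-) type_count_eq_0[of "{0, 1, 2}"] type_count_eq_0[of "{j, k}"] A_subset[of j]
      unfolding free t'(1) by auto
    then show ?thesis
      using card_layer_le_refined[of "A j" "{i, j}" j] that t'(2-) mem by (simp add: A_j card_free)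
  qed
  moreover have "type_count {k} = 0 \<and> 0 < card (A i) \<and> 0 < card (A j) \<and> 0 < card (Y - A k)"
    if "card (layer {i, j}) \<noteq> 0"
  proof -
    have ne: "layer {i, j} \<noteq> {}" using that by auto
    have "type_count {k} = 0"
      unfolding type_count_eq_0 using layer_nonempty(1)[OF ne] t'(2-) unfolding t'(1) by auto
    then show ?thesis
      using layer_nonempty_card(1)[OF ne mem(1)] layer_nonempty_card(1)[OF ne mem(2)] layer_nonempty_card(2)[OF ne mem(3)] t'(2-) by simp
  qed
  ultimately show ?thesis
    using card_layer_le[of "{i, j}"] unfolding node_bound_def card_free card_A[OF t] A_j avoid_k
    by (auto simp: add.commute add.left_commute)
qed

lemma pole_bound_empty:
  assumes t: "triple i j k"
  shows "pole_bound (type_count {}) (type_count {0, 1, 2}) (type_count {i}) (type_count {i, j}) (type_count {j}) (type_count {j, k})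
    (type_count {k}) (type_count {k, i}) (card (layer {}))"
proof -
  have "free {} = {}" by (auto simp: free_def)
  then have "card (layer {}) \<le> 1" using card_layer_le[of "{}"] by simp
  moreover have "type_count {0, 1, 2} = 0 \<and> 0 < card (Y - A i) \<and> 0 < card (Y - A j) \<and> 0 < card (Y - A k)"
    if "card (layer {}) \<noteq> 0"
  proof -
    have ne: "layer {} \<noteq> {}" using that by auto
    have mem: "i \<in> {0, 1, 2}" "j \<in> {0, 1, 2}" "k \<in> {0, 1, 2}"
      using t unfolding triple_def by simp_all
    have "type_count {0, 1, 2} = 0"
      unfolding type_count_eq_0 using layer_nonempty(1)[OF ne] by auto
    then show ?thesis
      using layer_nonempty_card(2)[OF ne mem(1)] layer_nonempty_card(2)[OF ne mem(2)] layer_nonempty_card(2)[OF ne mem(3)] by simp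
  qed
  ultimately show ?thesis
    unfolding pole_bound_def card_diff_A[OF t] card_diff_A[OF triple_rotate[OF t]]
      card_diff_A[OF triple_rotate[OF triple_rotate[OF t]]]
    by auto
qed

lemma pole_bound_full:
  assumes t: "triple i j k"
  shows "pole_bound (type_count {0, 1, 2}) (type_count {}) (type_count {i, j}) (type_count {j}) (type_count {j, k})
    (type_count {k}) (type_count {k, i}) (type_count {i}) (card (layer {0, 1, 2}))"
proof -
  have "free {0, 1, 2} = {}" by (auto simp: free_def)
  then have "card (layer {0, 1, 2}) \<le> 1" using card_layer_le[of "{0, 1, 2}"] by simp
  moreover have "type_count {} = 0 \<and> 0 < card (A i) \<and> 0 < card (A j) \<and> 0 < card (A k)"
    if "card (layer {0, 1, 2}) \<noteq> 0"
  proof -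
    have ne: "layer {0, 1, 2} \<noteq> {}" using that by auto
    have mem: "i \<in> {0, 1, 2}" "j \<in> {0, 1, 2}" "k \<in> {0, 1, 2}"
      using t unfolding triple_def by simp_all
    have "type_count {} = 0"
      unfolding type_count_eq_0 using layer_nonempty(1)[OF ne] by auto
    then show ?thesis
      using layer_nonempty_card(1)[OF ne mem(1)] layer_nonempty_card(1)[OF ne mem(2)] layer_nonempty_card(1)[OF ne mem(3)] mem by simp
  qed
  ultimately show ?thesis
    unfolding pole_bound_def card_A[OF t] card_A[OF triple_rotate[OF t]]
      card_A[OF triple_rotate[OF triple_rotate[OF t]]]
    by auto
qed

lemma card_F:
  "card F = card (layer {}) + card (layer {0, 1, 2}) + card (layer {0}) + card (layer {0, 1}) +
    card (layer {1}) + card (layer {1, 2}) + card (layer {2}) + card (layer {2, 0})"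
proof -
  have "F = Sigma (Pow {0, 1, 2}) layer" using F_subset unfolding layer_def by auto
  also have "card \<dots> = (\<Sum>S\<in>Pow {0, 1, 2}. card (layer S))"
    by (rule card_SigmaI) (auto simp: finite_layer)
  also have "\<dots> = card (layer {}) + card (layer {0, 1, 2}) + card (layer {0}) +
      card (layer {0, 1}) + card (layer {1}) + card (layer {1, 2}) + card (layer {2}) + card (layer {2, 0})"
    by (simp add: sum_Pow_insert insert_commute)
  finally show ?thesis .
qed

lemma card_F_less:
  assumes "5 \<le> card Y"
  shows "card F < central (card Y + 1)"
proof -
  have t: "triple 0 1 2" by (auto simp: triple_def)
  note t1 = triple_rotate[OF t] note t2 = triple_rotate[OF t1]
  note pair = card_two_layers_less
  have card_Y: "card Y = type_count {} + type_count {0, 1, 2} + type_count {0} + type_count {0, 1} + type_count {1} + type_count {1, 2} +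
      type_count {2} + type_count {2, 0}"
    using card_eq_counts[OF t, of "\<lambda>_ _ _. True"] by simp
  have le: "type_count {} \<le> 1" "type_count {0, 1, 2} \<le> 1"
    using none_le_1 all_le_1 unfolding type_count_def by auto
  have "hexagon (central (card Y + 1)) (card F) (type_count {}) (type_count {0, 1, 2}) (card (layer {})) (card (layer {0, 1, 2}))
    (type_count {0}) (type_count {0, 1}) (type_count {1}) (type_count {1, 2}) (type_count {2}) (type_count {2, 0})
    (card (layer {0})) (card (layer {0, 1})) (card (layer {1})) (card (layer {1, 2})) (card (layer {2}))
    (card (layer {2, 0}))"
    unfolding hexagon_def
    using assms le card_F node_bound_single[OF t] node_bound_single[OF t1] node_bound_single[OF t2]
      node_bound_pair[OF t] node_bound_pair[OF t1] node_bound_pair[OF t2]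
      pole_bound_empty[OF t] pole_bound_full[OF t]
      pair[of 1 "{0}"] pair[of 0 "{1}"] pair[of 2 "{1}"] pair[of 1 "{2}"] pair[of 0 "{2}"] pair[of 2 "{0}"]
    by (simp add: card_Y insert_commute add.commute)
  then show ?thesis by (rule hexagon_less)
qed

end

section \<open>Orientations of complete tripartite graphs\<close>

lemma (in wf_digraph) awalk_cost_unit: "awalk_cost (\<lambda>_. 1) es = real (length es)"
  by (induction es) (auto simp: awalk_cost_def)

lemma (in wf_digraph) mu_le:
  assumes "awalk u es v"
  shows "\<mu> (\<lambda>_. 1) u v \<le> real (length es)"
  using min_cost_le_walk_cost[OF assms, of "\<lambda>_. 1"] by (simp add: awalk_cost_unit)

lemma (in wf_digraph) mu_ge:
  assumes "\<And>es. awalk u es v \<Longrightarrow> n \<le> length es"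
  shows "real n \<le> \<mu> (\<lambda>_. 1) u v"
  unfolding \<mu>_def by (rule INF_greatest) (use assms in \<open>auto simp: awalk_cost_unit\<close>)

definition within_two :: "'a pair_pre_digraph \<Rightarrow> 'a \<Rightarrow> 'a \<Rightarrow> bool" where
  "within_two D u v \<longleftrightarrow> u = v \<or> (u, v) \<in> parcs D \<or> (\<exists>w. (u, w) \<in> parcs D \<and> (w, v) \<in> parcs D)"

text \<open>Otherwise every walk has at least 3 arcs, and so has their infimum.\<close>

lemma (in pair_wf_digraph) within_two_mu:
  assumes "\<mu> (\<lambda>_. 1) u v < 3"
  shows "within_two G u v"
proof (rule ccontr)
  assume not: "\<not> within_two G u v"
  have "3 \<le> length es" if "awalk u es v" for es
  proof (rule ccontr)
    assume "\<not> 3 \<le> length es"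
    then consider "es = []" | e where "es = [e]" | e e' where "es = [e, e']"
      by (cases es; cases "tl es"; cases "tl (tl es)") auto
    then show False
      using that not unfolding within_two_def
      by cases (auto simp: awalk_Cons_iff awalk_Nil_iff)
  qed
  then have "real 3 \<le> \<mu> (\<lambda>_. 1) u v" by (rule mu_ge)
  with assms show False by (simp add: not_le[symmetric])
qed

lemma (in pair_wf_digraph) mu_ge_two:
  assumes "u \<noteq> v" "(u, v) \<notin> parcs G"
  shows "2 \<le> \<mu> (\<lambda>_. 1) u v"
proof -
  have "2 \<le> length es" if "awalk u es v" for es
  proof (rule ccontr)
    assume "\<not> 2 \<le> length es"
    then consider "es = []" | e where "es = [e]"
      by (cases es; cases "tl es") auto
    then show False
      using that assms by cases (auto simp: awalk_Cons_iff awalk_Nil_iff)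
  qed
  then have "real 2 \<le> \<mu> (\<lambda>_. 1) u v" by (rule mu_ge)
  then show ?thesis by simp
qed

lemma (in pair_wf_digraph) within_two_awalk:
  assumes "within_two G u v" "u \<in> pverts G"
  obtains es where "awalk u es v" "length es \<le> 2"
proof -
  from assms(1) consider "u = v" | "(u, v) \<in> parcs G" | w where "(u, w) \<in> parcs G" "(w, v) \<in> parcs G"
    unfolding within_two_def by blast
  then show thesis
  proof cases
    case 1
    with assms(2) show thesis by (intro that[of "[]"]) (auto simp: awalk_Nil_iff)
  next
    case 2
    then show thesis
      by (intro that[of "[(u, v)]"]) (auto simp: awalk_Cons_iff awalk_Nil_iff dest: arc_snd_in_verts)
  next
    case (3 w)
    then show thesis
      by (intro that[of "[(u, w), (w, v)]"]) (auto simp: awalk_Cons_iff awalk_Nil_iff dest: arc_snd_in_verts)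
  qed
qed

lemma (in wf_digraph) diam_le:
  assumes "\<And>u v. u \<in> verts G \<Longrightarrow> v \<in> verts G \<Longrightarrow> \<exists>es. awalk u es v \<and> length es \<le> n"
  shows "diam G \<le> real n"
  unfolding diam_def
proof (rule SUP_least, clarify)
  fix u v assume "u \<in> verts G" "v \<in> verts G"
  then obtain es where "awalk u es v" "length es \<le> n" using assms by blast
  then show "\<mu> (\<lambda>_. 1) u v \<le> real n"
    using mu_le[of u es v] by (meson ereal_less_eq(3) of_nat_mono order_trans)
qed

lemma (in wf_digraph) mu_le_diam:
  "u \<in> verts G \<Longrightarrow> v \<in> verts G \<Longrightarrow> \<mu> (\<lambda>_. 1) u v \<le> diam G"
  unfolding diam_def by (rule SUP_upper2[of "(u, v)"]) auto

lemma (in pair_wf_digraph) strongly_connectedI_awalk: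
  assumes "pverts G \<noteq> {}" "\<And>u v. u \<in> pverts G \<Longrightarrow> v \<in> pverts G \<Longrightarrow> \<exists>es. awalk u es v"
  shows "strongly_connected (with_proj G)"
  using assms by (auto simp: strongly_connected_def reachable_awalk)

section \<open>From an orientation of diameter two to a set family\<close>

lemma pverts_complete_tripartite:
  "pverts (complete_tripartite l m n) = {0} \<times> {..<l} \<union> {1} \<times> {..<m} \<union> {2} \<times> {..<n}"
  by (simp add: complete_tripartite_def Let_def)

lemma parcs_complete_tripartite:
  "(u, v) \<in> parcs (complete_tripartite l m n) \<longleftrightarrow>
    u \<in> pverts (complete_tripartite l m n) \<and> v \<in> pverts (complete_tripartite l m n) \<and> fst u \<noteq> fst v"
  by (simp add: complete_tripartite_def Let_def)

text \<open>Where an arc is missing, a path of length 2 must pass through a part other than those of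
  its ends. Read in terms of \<open>A\<close>, \<open>S\<close> and \<open>T\<close>, this gives the
  assumptions of \<open>diameter_two_family\<close>.\<close>

lemma orientation_within_two_less:
  assumes D: "orientation (complete_tripartite 3 p q) D" and "5 \<le> p"
    and two: "\<And>u v. u \<in> pverts D \<Longrightarrow> v \<in> pverts D \<Longrightarrow> within_two D u v"
  shows "q < central (p + 1)"
proof -
  define A where "A i = {j. j < p \<and> ((0, i), (1, j)) \<in> parcs D}" for i :: nat
  define S where "S k = {i \<in> {0, 1, 2}. ((2, k), (0, i)) \<in> parcs D}" for k :: nat
  define T where "T k = {j. j < p \<and> ((2, k), (1, j)) \<in> parcs D}" for k :: nat
  define F where "F = (\<lambda>k. (S k, T k)) ` {..<q}"
  have V: "pverts D = {0} \<times> {..<3} \<union> {1} \<times> {..<p} \<union> {2} \<times> {..<q}"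
    using D by (simp add: orientation_def pverts_complete_tripartite)
  have i3: "i \<in> {0, 1, 2} \<longleftrightarrow> i < 3" for i :: nat by auto
  have arc: "u \<in> pverts D \<and> v \<in> pverts D \<and> fst u \<noteq> fst v" if "(u, v) \<in> parcs D" for u v
    using D that parcs_complete_tripartite[of u v] by (auto simp: orientation_def)
  have flip: "(v, u) \<in> parcs D \<longleftrightarrow> (u, v) \<notin> parcs D"
    if "u \<in> pverts D" "v \<in> pverts D" "fst u \<noteq> fst v" for u v
    using D that parcs_complete_tripartite[of u v 3 p q] by (auto simp: orientation_def)
  have V': "(0, i) \<in> pverts D \<longleftrightarrow> i < 3" "(1, j) \<in> pverts D \<longleftrightarrow> j < p" "(2, k) \<in> pverts D \<longleftrightarrow> k < q" for i j k
    by (auto simp: V)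
  have mid: "(\<exists>i<3. (u, (0, i)) \<in> parcs D \<and> ((0, i), v) \<in> parcs D) \<or>
      (\<exists>j<p. (u, (1, j)) \<in> parcs D \<and> ((1, j), v) \<in> parcs D) \<or>
      (\<exists>k<q. (u, (2, k)) \<in> parcs D \<and> ((2, k), v) \<in> parcs D)"
    if uv: "u \<in> pverts D" "v \<in> pverts D" "u \<noteq> v" "(u, v) \<notin> parcs D" for u v
  proof -
    obtain w where w: "(u, w) \<in> parcs D" "(w, v) \<in> parcs D"
      using two[OF uv(1,2)] uv(3,4) unfolding within_two_def by blast
    then have "w \<in> pverts D" using arc by blast
    with w show ?thesis unfolding V by auto
  qed
  have same: "((a, i), (a, j)) \<notin> parcs D" for a i j
    using arc[of "(a, i)" "(a, j)"] by auto
  have SI: "i \<in> S k \<longleftrightarrow> ((2, k), (0, i)) \<in> parcs D" "i \<notin> S k \<longleftrightarrow> ((0, i), (2, k)) \<in> parcs D"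
    if "i < 3" "k < q" for i k
    using that flip[of "(2, k)" "(0, i)"] by (auto simp: S_def V)
  have TI: "j \<in> T k \<longleftrightarrow> ((2, k), (1, j)) \<in> parcs D" "j \<notin> T k \<longleftrightarrow> ((1, j), (2, k)) \<in> parcs D"
    if "j < p" "k < q" for j k
    using that flip[of "(2, k)" "(1, j)"] by (auto simp: T_def V)
  have AI: "j \<in> A i \<longleftrightarrow> ((0, i), (1, j)) \<in> parcs D" "j \<notin> A i \<longleftrightarrow> ((1, j), (0, i)) \<in> parcs D"
    if "j < p" "i < 3" for i j
    using that flip[of "(0, i)" "(1, j)"] by (auto simp: A_def V)
  have anti: "k = l" if "k < q" "l < q" "S k \<subseteq> S l" "T k \<subseteq> T l" for k l
  proof (rule ccontr)
    assume "k \<noteq> l"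
    with mid[of "(2, k)" "(2, l)", unfolded V'] that(1,2) same
    consider i where "i < 3" "((2, k), (0, i)) \<in> parcs D" "((0, i), (2, l)) \<in> parcs D"
      | j where "j < p" "((2, k), (1, j)) \<in> parcs D" "((1, j), (2, l)) \<in> parcs D"
      by blast
    then show False
    proof cases
      case (1 i)
      then show False using SI(1)[of i k] SI(2)[of i l] that by auto
    next
      case (2 j)
      then show False using TI(1)[of j k] TI(2)[of j l] that by auto
    qed
  qed
  have above: "\<not> A i \<subseteq> T k" if k: "k < q" and i: "i \<in> S k" for i k
  proof -
    have i': "i < 3" using i by (auto simp: S_def)
    have "((0, i), (2, k)) \<notin> parcs D" using SI[OF i' k] i by auto
    then obtain j where "j < p" "((0, i), (1, j)) \<in> parcs D" "((1, j), (2, k)) \<in> parcs D"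
      using mid[of "(0, i)" "(2, k)", unfolded V'] i' k by (auto simp: same)
    then show ?thesis
      using TI(2)[of j k] AI(1)[of j i] k i' by auto
  qed
  have below: "\<not> T k \<subseteq> A i" if k: "k < q" and i: "i \<in> {0, 1, 2} - S k" for i k
  proof -
    have i': "i < 3" "i \<notin> S k" using i by auto
    have "((2, k), (0, i)) \<notin> parcs D" using SI[OF i'(1) k] i' by auto
    then obtain j where "j < p" "((2, k), (1, j)) \<in> parcs D" "((1, j), (0, i)) \<in> parcs D"
      using mid[of "(2, k)" "(0, i)", unfolded V'] i' k by (auto simp: same)
    then show ?thesis
      using TI(1)[of j k] AI(2)[of j i] k i'(1) by auto
  qed
  have cover: "\<exists>i\<in>S k. y \<in> A i" if k: "k < q" and y: "y \<in> {..<p} - T k" for k y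
  proof -
    have y': "y < p" "y \<notin> T k" using y by auto
    have "((2, k), (1, y)) \<notin> parcs D" using TI[OF y'(1) k] y' by auto
    then obtain i where "i < 3" "((2, k), (0, i)) \<in> parcs D" "((0, i), (1, y)) \<in> parcs D"
      using mid[of "(2, k)" "(1, y)", unfolded V'] y' k by (auto simp: same)
    then show ?thesis
      using SI(1)[of i k] AI(1)[of y i] k y' by auto
  qed
  have avoid: "\<exists>i\<in>{0, 1, 2} - S k. y \<notin> A i" if k: "k < q" and y: "y \<in> T k" for k y
  proof -
    have y': "y < p" using y by (auto simp: T_def)
    have "((1, y), (2, k)) \<notin> parcs D" using TI[OF y' k] y by auto
    then obtain i where "i < 3" "((1, y), (0, i)) \<in> parcs D" "((0, i), (2, k)) \<in> parcs D"
      using mid[of "(1, y)" "(2, k)", unfolded V'] y' k by (auto simp: same)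
    then show ?thesis
      using SI(2)[of i k] AI(2)[of y i] k y' i3[of i] by auto
  qed
  have eq: "y = y'" if y: "y < p" "y' < p"
    and Y: "(\<forall>i\<in>{0, 1, 2}. y \<notin> A i \<and> y' \<notin> A i) \<or> (\<forall>i\<in>{0, 1, 2}. y \<in> A i \<and> y' \<in> A i)" for y y'
  proof (rule ccontr)
    assume "y \<noteq> y'"
    with mid[of "(1, y)" "(1, y')", unfolded V'] y same
    consider i where "i < 3" "((1, y), (0, i)) \<in> parcs D" "((0, i), (1, y')) \<in> parcs D"
      | k where "k < q" "((1, y), (2, k)) \<in> parcs D" "((2, k), (1, y')) \<in> parcs D"
      by blast
    then show False
    proof cases
      case (1 i)
      then show False using Y i3[of i] AI(1)[of y' i] AI(2)[of y i] y by auto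
    next
      case (2 k)
      \<comment> \<open>A middle vertex in the part of size \<open>q\<close> puts \<open>y\<close>
        into some \<open>A i\<close> and \<open>y'\<close> outside some \<open>A i'\<close>, so the
        two cannot share an extreme type.\<close>
      then have "y \<notin> T k" "y' \<in> T k" using TI(2)[of y k] TI(1)[of y' k] y by auto
      then obtain i i' where "i \<in> S k" "y \<in> A i" "i' \<in> {0, 1, 2}" "y' \<notin> A i'"
        using cover[of k y] avoid[of k y'] y \<open>k < q\<close> by blast
      moreover have "i \<in> {0, 1, 2}" using \<open>i \<in> S k\<close> unfolding S_def by blast
      ultimately show False using Y by blast
    qed
  qed
  have le_1: "card X \<le> 1" if "\<And>y y'. y \<in> X \<Longrightarrow> y' \<in> X \<Longrightarrow> y = y'" for X :: "nat set"
    using that by (cases "finite X") (auto simp: card_le_Suc0_iff_eq)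
  interpret diameter_two_family "{..<p}" A F
  proof
    show "F \<subseteq> Pow {0, 1, 2} \<times> Pow {..<p}" by (auto simp: F_def S_def T_def)
    show "card {y \<in> {..<p}. \<forall>i\<in>{0, 1, 2}. y \<notin> A i} \<le> 1"
      by (rule le_1) (use eq in blast)
    show "card {y \<in> {..<p}. \<forall>i\<in>{0, 1, 2}. y \<in> A i} \<le> 1"
      by (rule le_1) (use eq in blast)
    fix S' T' assume "(S', T') \<in> F"
    then obtain k where k: "k < q" "S' = S k" "T' = T k" unfolding F_def by auto
    show "\<not> A i \<subseteq> T'" if "i \<in> S'" for i
      using above[of k i] k that by simp
    show "\<not> T' \<subseteq> A i" if "i \<in> {0, 1, 2} - S'" for i
      using below[of k i] k that by simp
    show "\<exists>i\<in>S'. y \<in> A i" if "y \<in> {..<p} - T'" for y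
      using cover[of k y] k that by simp
    show "\<exists>i\<in>{0, 1, 2} - S'. y \<notin> A i" if "y \<in> T'" for y
      using avoid[of k y] k that by simp
    fix S'' T'' assume "(S'', T'') \<in> F" and le: "S' \<subseteq> S''" "T' \<subseteq> T''"
    then obtain l where l: "l < q" "S'' = S l" "T'' = T l" unfolding F_def by auto
    then have "k = l" using anti[of k l] k le by simp
    then show "S' = S'' \<and> T' = T''" using k l by simp
  qed (auto simp: A_def)
  have "inj_on (\<lambda>k. (S k, T k)) {..<q}"
    by (rule inj_onI) (use anti in auto)
  then have "card F = q" by (simp add: F_def card_image)
  then show ?thesis using card_F_less \<open>5 \<le> p\<close> by simp
qed

section \<open>The orientation that attains the bound\<close>

definition orient :: "'a pair_pre_digraph \<Rightarrow> ('a \<Rightarrow> 'a \<Rightarrow> bool) \<Rightarrow> 'a pair_pre_digraph" where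
  "orient G h = \<lparr> pverts = pverts G, parcs = {(u, v) \<in> parcs G. h u v} \<rparr>"

lemma orientation_orient:
  "(\<And>u v. (u, v) \<in> parcs G \<Longrightarrow> h u v \<longleftrightarrow> \<not> h v u) \<Longrightarrow> sym (parcs G) \<Longrightarrow> orientation G (orient G h)"
  unfolding orientation_def orient_def by (auto dest: symD)

text \<open>Consulted only for \<open>fst u < fst v\<close>. It yields \<open>A 0 = {..<p}\<close>,
  \<open>A 1 = {..<m}\<close> and \<open>A 2 = {}\<close>; \<open>g k\<close> is the pair
  \<open>(s, T)\<close> of the vertex \<open>(2, k)\<close>.\<close>

definition forward :: "nat \<Rightarrow> (nat \<Rightarrow> bool \<times> nat set) \<Rightarrow> nat \<times> nat \<Rightarrow> nat \<times> nat \<Rightarrow> bool" where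
  "forward m g u v =
    (if fst u = 0 \<and> fst v = 1 then snd u = 0 \<or> snd u = 1 \<and> snd v < m
     else if fst u = 0 then snd u = 2 \<or> snd u = 1 \<and> \<not> fst (g (snd v))
     else snd u \<notin> snd (g (snd v)))"

definition tripartite_orientation :: "nat \<Rightarrow> nat \<Rightarrow> nat \<Rightarrow> (nat \<Rightarrow> bool \<times> nat set) \<Rightarrow> (nat \<times> nat) pair_pre_digraph" where
  "tripartite_orientation p q m g = orient (complete_tripartite 3 p q)
     (\<lambda>u v. if fst u < fst v then forward m g u v else \<not> forward m g v u)"

lemma orientation_tripartite:
  "orientation (complete_tripartite 3 p q) (tripartite_orientation p q m g)"
  unfolding tripartite_orientation_def
  by (rule orientation_orient) (auto simp: parcs_complete_tripartite intro!: symI)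

lemma tripartite_arcs:
  fixes p q m :: nat and g :: "nat \<Rightarrow> bool \<times> nat set"
  defines "D \<equiv> tripartite_orientation p q m g"
  shows "((0, i), (1, j)) \<in> parcs D \<longleftrightarrow> i < 3 \<and> j < p \<and> (i = 0 \<or> i = 1 \<and> j < m)"
    and "((1, j), (0, i)) \<in> parcs D \<longleftrightarrow> i < 3 \<and> j < p \<and> \<not> (i = 0 \<or> i = 1 \<and> j < m)"
    and "((0, i), (2, k)) \<in> parcs D \<longleftrightarrow> i < 3 \<and> k < q \<and> (i = 2 \<or> i = 1 \<and> \<not> fst (g k))"
    and "((2, k), (0, i)) \<in> parcs D \<longleftrightarrow> i < 3 \<and> k < q \<and> \<not> (i = 2 \<or> i = 1 \<and> \<not> fst (g k))"
    and "((1, j), (2, k)) \<in> parcs D \<longleftrightarrow> j < p \<and> k < q \<and> j \<notin> snd (g k)"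
    and "((2, k), (1, j)) \<in> parcs D \<longleftrightarrow> j < p \<and> k < q \<and> j \<in> snd (g k)"
  by (auto simp: D_def tripartite_orientation_def orient_def forward_def parcs_complete_tripartite
      pverts_complete_tripartite)

lemma within_twoI: "(u, w) \<in> parcs D \<Longrightarrow> (w, v) \<in> parcs D \<Longrightarrow> within_two D u v"
  unfolding within_two_def by blast

lemma within_two_arc: "(u, v) \<in> parcs D \<Longrightarrow> within_two D u v"
  unfolding within_two_def by blast

text \<open>\<open>low\<close>, \<open>high\<close> and \<open>sep\<close> provide middle vertices
  in the part of size \<open>q\<close>. \<open>sep\<close> omits \<open>m <= y\<close> with
  \<open>y' < m\<close>, since then \<open>(0, 1)\<close> is a middle vertex. Pairs inside the part
  of size \<open>q\<close> need distinct values of \<open>g\<close> and are treated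
  separately.\<close>

lemma tripartite_within_two:
  fixes p q m :: nat and g :: "nat \<Rightarrow> bool \<times> nat set"
  defines "D \<equiv> tripartite_orientation p q m g"
  assumes m: "2 \<le> m" "m + 2 \<le> p"
    and T: "\<And>k. k < q \<Longrightarrow> snd (g k) \<subseteq> {..<p} \<and> snd (g k) \<noteq> {} \<and> snd (g k) \<noteq> {..<p}"
    and above: "\<And>k. k < q \<Longrightarrow> fst (g k) \<Longrightarrow> \<not> {..<m} \<subseteq> snd (g k)"
    and below: "\<And>k. k < q \<Longrightarrow> \<not> fst (g k) \<Longrightarrow> \<not> snd (g k) \<subseteq> {..<m}"
    and low: "\<And>y. y < m \<Longrightarrow> \<exists>k<q. fst (g k) \<and> y \<notin> snd (g k)"
    and high: "\<And>y. m \<le> y \<Longrightarrow> y < p \<Longrightarrow> \<exists>k<q. \<not> fst (g k) \<and> y \<in> snd (g k)"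
    and sep: "\<And>y y'. y < p \<Longrightarrow> y' < p \<Longrightarrow> y \<noteq> y' \<Longrightarrow> y < m \<or> m \<le> y' \<Longrightarrow>
      \<exists>k<q. y \<notin> snd (g k) \<and> y' \<in> snd (g k)"
    and uv: "u \<in> pverts D" "v \<in> pverts D" "fst u \<noteq> 2 \<or> fst v \<noteq> 2"
  shows "within_two D u v"
proof -
  note arcs = tripartite_arcs[of _ _ p q m g, folded D_def]
  note arcs = arcs arcs[unfolded One_nat_def]
  have V: "pverts D = {0} \<times> {..<3} \<union> {1} \<times> {..<p} \<union> {2} \<times> {..<q}"
    by (simp add: D_def tripartite_orientation_def orient_def pverts_complete_tripartite)
  \<comment> \<open>For \<open>y = m\<close> the partner in \<open>sep\<close> is
    \<open>m + 1\<close>, available since \<open>m + 2 <= p\<close>; below, \<open>y = 0\<close>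
    uses the partner 1, available since \<open>2 <= m\<close>.\<close>
  have out: "\<exists>k<q. y \<notin> snd (g k)" if "y < p" for y
  proof -
    consider "y < m" | "y = m" | "m < y" by linarith
    then show ?thesis
      by cases (use low[of y] sep[of y m] sep[of y "m + 1"] that m in auto)
  qed
  have into: "\<exists>k<q. y \<in> snd (g k)" if "y < p" for y
  proof -
    consider "m \<le> y" | "y = 0" | "0 < y" "y < m" by linarith
    then show ?thesis
      by cases (use high[of y] sep[of 0 y] sep[of 1 y] that m in auto)
  qed
  obtain k0 where k0: "k0 < q" "fst (g k0)" using low[of 0] m by auto
  obtain k1 where k1: "k1 < q" "\<not> fst (g k1)" using high[of m] m by auto
  have two_subset: "\<exists>j<p. j \<notin> snd (g k)" "\<exists>j<p. j \<in> snd (g k)" if "k < q" for k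
    using T[OF that] by blast+
  have i_cases: "i = 0 \<or> i = 1 \<or> i = 2" if "i < 3" for i :: nat using that by auto
  have w00: "within_two D (0, i) (0, j)" if ij: "i < 3" "j < 3" for i j
  proof -
    consider "i = j" | "i = 0" "j = 1" | "i = 0" "j = 2" | "i = 1" "j = 0" | "i = 1" "j = 2"
      | "i = 2" "j = 0" | "i = 2" "j = 1"
      using i_cases[OF ij(1)] i_cases[OF ij(2)] by auto
    then show ?thesis
    proof cases
      case 1 then show ?thesis by (simp add: within_two_def)
    next
      case 2 then show ?thesis by (intro within_twoI[of _ "(1, m)"]) (use m in \<open>simp_all add: arcs\<close>)
    next
      case 3 then show ?thesis by (intro within_twoI[of _ "(1, 0)"]) (use m in \<open>simp_all add: arcs\<close>)
    next
      case 4 then show ?thesis by (intro within_twoI[of _ "(2, k1)"]) (use k1 in \<open>simp_all add: arcs\<close>)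
    next
      case 5 then show ?thesis by (intro within_twoI[of _ "(1, 0)"]) (use m in \<open>simp_all add: arcs\<close>)
    next
      case 6 then show ?thesis by (intro within_twoI[of _ "(2, k1)"]) (use k1 in \<open>simp_all add: arcs\<close>)
    next
      case 7 then show ?thesis by (intro within_twoI[of _ "(2, k0)"]) (use k0 in \<open>simp_all add: arcs\<close>)
    qed
  qed
  have w01: "within_two D (0, i) (1, j)" if ij: "i < 3" "j < p" for i j
  proof -
    consider "i = 0 \<or> i = 1 \<and> j < m" | "i = 1" "m \<le> j" | "i = 2"
      using i_cases[OF ij(1)] by linarith
    then show ?thesis
    proof cases
      case 1 then show ?thesis by (intro within_two_arc) (use ij in \<open>simp add: arcs\<close>)
    next
      case 2
      then obtain k where "k < q" "\<not> fst (g k)" "j \<in> snd (g k)" using high ij by blast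
      with 2 ij show ?thesis by (intro within_twoI[of _ "(2, k)"]) (simp_all add: arcs)
    next
      case 3
      obtain k where "k < q" "j \<in> snd (g k)" using into \<open>j < p\<close> by blast
      with 3 ij show ?thesis by (intro within_twoI[of _ "(2, k)"]) (simp_all add: arcs)
    qed
  qed
  have w10: "within_two D (1, j) (0, i)" if ij: "i < 3" "j < p" for i j
  proof -
    consider "i = 2 \<or> i = 1 \<and> m \<le> j" | "i = 1" "j < m" | "i = 0"
      using i_cases[OF ij(1)] by linarith
    then show ?thesis
    proof cases
      case 1 then show ?thesis by (intro within_two_arc) (use ij in \<open>auto simp add: arcs\<close>)
    next
      case 2
      then obtain k where "k < q" "fst (g k)" "j \<notin> snd (g k)" using low by blast
      with 2 ij show ?thesis by (intro within_twoI[of _ "(2, k)"]) (simp_all add: arcs)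
    next
      case 3
      obtain k where "k < q" "j \<notin> snd (g k)" using out \<open>j < p\<close> by blast
      with 3 ij show ?thesis by (intro within_twoI[of _ "(2, k)"]) (simp_all add: arcs)
    qed
  qed
  have w02: "within_two D (0, i) (2, k)" if ij: "i < 3" "k < q" for i k
  proof -
    consider "i = 2 \<or> i = 1 \<and> \<not> fst (g k)" | "i = 1" "fst (g k)" | "i = 0"
      using i_cases[OF ij(1)] by linarith
    then show ?thesis
    proof cases
      case 1 then show ?thesis by (intro within_two_arc) (use ij in \<open>simp add: arcs\<close>)
    next
      case 2
      then obtain j where "j < m" "j \<notin> snd (g k)" using above[OF ij(2)] by auto
      with 2 ij m show ?thesis by (intro within_twoI[of _ "(1, j)"]) (simp_all add: arcs)
    next
      case 3
      obtain j where "j < p" "j \<notin> snd (g k)" using two_subset(1) \<open>k < q\<close> by blast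
      with 3 ij show ?thesis by (intro within_twoI[of _ "(1, j)"]) (simp_all add: arcs)
    qed
  qed
  have w20: "within_two D (2, k) (0, i)" if ij: "i < 3" "k < q" for i k
  proof -
    consider "i = 0 \<or> i = 1 \<and> fst (g k)" | "i = 1" "\<not> fst (g k)" | "i = 2"
      using i_cases[OF ij(1)] by linarith
    then show ?thesis
    proof cases
      case 1 then show ?thesis by (intro within_two_arc) (use ij in \<open>auto simp add: arcs\<close>)
    next
      case 2
      then obtain j where "j \<in> snd (g k)" "\<not> j < m" using below[OF ij(2)] by auto
      with 2 ij T[OF ij(2)] show ?thesis by (intro within_twoI[of _ "(1, j)"]) (auto simp add: arcs)
    next
      case 3
      obtain j where "j < p" "j \<in> snd (g k)" using two_subset(2) \<open>k < q\<close> by blast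
      with 3 ij show ?thesis by (intro within_twoI[of _ "(1, j)"]) (simp_all add: arcs)
    qed
  qed
  have w11: "within_two D (1, j) (1, j')" if ij: "j < p" "j' < p" for j j'
  proof -
    consider "j = j'" | "m \<le> j" "j' < m" | "j \<noteq> j'" "j < m \<or> m \<le> j'" by linarith
    then show ?thesis
    proof cases
      case 1 then show ?thesis by (simp add: within_two_def)
    next
      case 2 with ij show ?thesis by (intro within_twoI[of _ "(0, 1)"]) (simp_all add: arcs)
    next
      case 3
      then obtain k where "k < q" "j \<notin> snd (g k)" "j' \<in> snd (g k)" using sep ij by blast
      with ij show ?thesis by (intro within_twoI[of _ "(2, k)"]) (simp_all add: arcs)
    qed
  qed
  have w12: "within_two D (1, j) (2, k)" if ij: "j < p" "k < q" for j k
    using within_two_arc[of "(1, j)" "(2, k)" D] within_twoI[of "(1, j)" "(0, 2)" D "(2, k)"] ij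
    by (cases "j \<in> snd (g k)") (simp_all add: arcs)
  have w21: "within_two D (2, k) (1, j)" if ij: "j < p" "k < q" for j k
    using within_two_arc[of "(2, k)" "(1, j)" D] within_twoI[of "(2, k)" "(0, 0)" D "(1, j)"] ij
    by (cases "j \<in> snd (g k)") (simp_all add: arcs)
  show ?thesis
    using uv w00 w01 w10 w02 w20 w11 w12 w21 unfolding V by auto
qed

section \<open>The near-middle families\<close>

text \<open>\<open>(s, T)\<close> encodes the out-neighbours of a vertex of the part of size \<open>q\<close>: the set \<open>T\<close>, the vertex 0
  of the part of size 3 and, if \<open>s\<close> holds, the vertex 1 of that part.\<close>

definition near_middle :: "nat \<Rightarrow> nat \<Rightarrow> (bool \<times> nat set) set" where
  "near_middle p m = {False} \<times> ({T. T \<subseteq> {..<p} \<and> card T = m} - {{..<m}}) \<union>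
     {True} \<times> {T. T \<subseteq> {..<p} \<and> card T = m - 1}"

lemma near_middle_iff:
  "(s, T) \<in> near_middle p m \<longleftrightarrow> T \<subseteq> {..<p} \<and> card T = (if s then m - 1 else m) \<and> (s \<or> T \<noteq> {..<m})"
  by (cases s) (simp_all add: near_middle_def)

definition separating :: "nat \<Rightarrow> nat \<Rightarrow> (bool \<times> nat set) set \<Rightarrow> bool" where
  "separating p m B \<longleftrightarrow> (\<forall>y<m. \<exists>x\<in>B. fst x \<and> y \<notin> snd x) \<and>
     (\<forall>y. m \<le> y \<longrightarrow> y < p \<longrightarrow> (\<exists>x\<in>B. \<not> fst x \<and> y \<in> snd x)) \<and>
     (\<forall>y y'. y < p \<longrightarrow> y' < p \<longrightarrow> y \<noteq> y' \<longrightarrow> y < m \<or> m \<le> y' \<longrightarrow> (\<exists>x\<in>B. y \<notin> snd x \<and> y' \<in> snd x))"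

lemma separating_mono: "separating p m B \<Longrightarrow> B \<subseteq> C \<Longrightarrow> separating p m C"
  unfolding separating_def Bex_def by (intro conjI allI impI; blast)

lemma finite_near_middle: "finite (near_middle p m)"
  unfolding near_middle_def by simp

text \<open>Pascal's rule; the missing 1 is the excluded set \<open>{..<m}\<close>, which is
  \<open>A 1\<close>.\<close>

lemma card_near_middle:
  assumes "0 < m" "m \<le> p"
  shows "card (near_middle p m) + 1 = (p + 1) choose m"
proof -
  have "card {T. T \<subseteq> {..<p} \<and> card T = k} = p choose k" for k
    using n_subsets[of "{..<p}" k] by simp
  moreover have "{..<m} \<in> {T. T \<subseteq> {..<p} \<and> card T = m}" using assms by auto
  moreover have "0 < p choose m" using assms by simp
  ultimately have "card (near_middle p m) = (p choose m) - 1 + (p choose (m - 1))"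
    unfolding near_middle_def by (subst card_Un_disjoint) (auto simp: card_cartesian_product_singleton card_Diff_singleton)
  moreover have "(p + 1) choose m = (p choose (m - 1)) + (p choose m)"
    using assms by (cases m) auto
  ultimately show ?thesis using \<open>0 < p choose m\<close> by simp
qed

text \<open>With \<open>m = n + 1\<close>, the family has at most \<open>n + 1\<close> pairs for odd
  \<open>p\<close> and \<open>n + 3\<close> for even \<open>p\<close>.\<close>

lemma separating_family_exists:
  assumes "5 \<le> p" "m = (p + 1) div 2"
  shows "\<exists>B \<subseteq> near_middle p m. card B \<le> p \<and> separating p m B"
proof -
  define n where "n = m - 1"
  have n: "2 \<le> n" "m = n + 1" "p = 2 * n + 1 \<or> p = 2 * n + 2"
    using assms by (auto simp: n_def)
  \<comment> \<open>The vertices \<open>i < n\<close> are matched with \<open>n + 1 + i\<close>: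
    \<open>T i\<close> contains exactly one vertex below \<open>n\<close> and misses exactly one of
    \<open>n + 1, ..., 2 * n\<close>. The unmatched vertex \<open>n\<close> is left to
    \<open>{n..<2 * n + 1}\<close>.\<close>
  define T where "T i = insert i ({n + 1..<2 * n + 1} - {n + 1 + i})" for i
  define B where "B = (\<lambda>i. (True, T i)) ` {..<n}"
  \<comment> \<open>For even \<open>p\<close> the last vertex \<open>2 * n + 1\<close> lies in no
    other set. The first of the two new sets separates it from the \<open>y > n\<close>, the second
    from the \<open>y <= n\<close>.\<close>
  define C where "C = (if p = 2 * n + 2 then {(False, insert (2 * n + 1) {..<n}), (True, {n + 2..<2 * n + 2})} else {})"
  let ?B = "insert (False, {n..<2 * n + 1}) (B \<union> C)"
  have "card (T i) = n" if "i < n" for i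
    unfolding T_def using that by (subst card_insert_disjoint) auto
  moreover have "T i \<subseteq> {..<p}" if "i < n" for i
    unfolding T_def using that n by auto
  ultimately have "B \<subseteq> near_middle p m"
    using n by (auto simp: B_def near_middle_iff)
  moreover have "2 * n \<in> {n..<2 * n + 1}" "2 * n \<notin> {..<m}" using n by auto
  then have "{n..<2 * n + 1} \<noteq> {..<m}" by blast
  then have "(False, {n..<2 * n + 1}) \<in> near_middle p m"
    using n unfolding near_middle_iff by auto
  moreover have "2 * n + 1 \<in> insert (2 * n + 1) {..<n}" "2 * n + 1 \<notin> {..<m}" using n by auto
  then have "insert (2 * n + 1) {..<n} \<noteq> {..<m}" by blast
  then have "C \<subseteq> near_middle p m"
    using n unfolding C_def by (auto simp: near_middle_iff)
  ultimately have "?B \<subseteq> near_middle p m" by blast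
  moreover have "card ?B \<le> p"
  proof -
    have "card B \<le> n" unfolding B_def using card_image_le[of "{..<n}"] by simp
    moreover have "card C \<le> (if p = 2 * n + 2 then 2 else 0)"
      unfolding C_def by (auto intro: card_insert_le_m1)
    moreover have "card ?B \<le> card (B \<union> C) + 1"
      by (rule card_insert_le_m1) simp_all
    moreover have "card (B \<union> C) \<le> card B + card C" by (rule card_Un_le)
    ultimately show ?thesis
      using n(1,3) by (cases "p = 2 * n + 2") simp_all
  qed
  moreover have "separating p m ?B"
    unfolding separating_def
  proof (intro conjI allI impI)
    fix y assume "y < m"
    then have "y \<notin> T (if y = 0 then 1 else 0)" using n by (auto simp: T_def)
    then show "\<exists>x\<in>?B. fst x \<and> y \<notin> snd x"
      using n by (intro bexI[of _ "(True, T (if y = 0 then 1 else 0))"]) (auto simp: B_def)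
  next
    fix y assume "m \<le> y" "y < p"
    then show "\<exists>x\<in>?B. \<not> fst x \<and> y \<in> snd x"
      using n by (cases "y < 2 * n + 1") (auto simp: C_def)
  next
    fix y y' assume y: "y < p" "y' < p" "y \<noteq> y'" "y < m \<or> m \<le> y'"
    have inB: "(True, T i) \<in> ?B" if "i < n" for i using that by (simp add: B_def)
    consider "y' < n" | "y' = n" | "n < y'" by linarith
    then show "\<exists>x\<in>?B. y \<notin> snd x \<and> y' \<in> snd x"
    proof cases
      case 1
      then show ?thesis using y n inB[of y'] by (intro bexI[of _ "(True, T y')"]) (auto simp: T_def)
    next
      case 2
      then show ?thesis using y n by (intro bexI[of _ "(False, {n..<2 * n + 1})"]) auto
    next
      case y': 3
      show ?thesis
      proof (cases "y' < 2 * n + 1")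
        case b: True
        consider "y < n \<or> 2 * n + 1 \<le> y" | "y = n" | "n < y" "y < 2 * n + 1" by linarith
        then show ?thesis
        proof cases
          case 1
          then show ?thesis using y' b by (intro bexI[of _ "(False, {n..<2 * n + 1})"]) auto
        next
          case 2
          \<comment> \<open>Any \<open>k < n\<close> works for which \<open>T k\<close> does not
            miss \<open>y'\<close>; \<open>2 <= n\<close> leaves a choice.\<close>
          define k where "k = (if y' = n + 1 then 1 else 0 :: nat)"
          have "k < n" "y' \<noteq> n + 1 + k" using n(1) by (auto simp: k_def)
          then show ?thesis using 2 y' b inB[of k] by (intro bexI[of _ "(True, T k)"]) (auto simp: T_def)
        next
          case 3
          then have "y - (n + 1) < n" "n + 1 + (y - (n + 1)) = y" by auto
          then show ?thesis
            using y' b y(3) inB[of "y - (n + 1)"]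
            by (intro bexI[of _ "(True, T (y - (n + 1)))"]) (auto simp: T_def)
        qed
      next
        case False
        then have p: "p = 2 * n + 2" "y' = 2 * n + 1" using y n by auto
        show ?thesis
        proof (cases "y \<le> n")
          case True
          then show ?thesis using n(1) p by (intro bexI[of _ "(True, {n + 2..<2 * n + 2})"]) (auto simp: C_def)
        next
          case False
          then show ?thesis using p y(3)
            by (intro bexI[of _ "(False, insert (2 * n + 1) {..<n})"]) (auto simp: C_def)
        qed
      qed
    qed
  qed
  ultimately show ?thesis by blast
qed

text \<open>Cardinalities suffice: \<open>m - 1\<close> elements cannot cover \<open>{..<m}\<close>,
  and a set of \<open>m\<close> elements other than \<open>{..<m}\<close> is not contained in
  it.\<close>

lemma near_middle_within_two:
  fixes p q m :: nat and g :: "nat \<Rightarrow> bool \<times> nat set"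
  defines "D \<equiv> tripartite_orientation p q m g"
  assumes m: "2 \<le> m" "m + 2 \<le> p" and g: "g ` {..<q} \<subseteq> near_middle p m" "separating p m (g ` {..<q})"
    and uv: "u \<in> pverts D" "v \<in> pverts D" "fst u \<noteq> 2 \<or> fst v \<noteq> 2"
  shows "within_two D u v"
proof -
  have "(fst (g k), snd (g k)) \<in> near_middle p m" if "k < q" for k
    using g(1) that by auto
  then have T: "snd (g k) \<subseteq> {..<p}" "card (snd (g k)) = (if fst (g k) then m - 1 else m)"
    "fst (g k) \<or> snd (g k) \<noteq> {..<m}" if "k < q" for k
    using that unfolding near_middle_iff by blast+
  show ?thesis
    unfolding D_def
  proof (rule tripartite_within_two[OF m])
    fix k assume k: "k < q"
    have "finite (snd (g k))" using T(1)[OF k] finite_subset by blast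
    show "snd (g k) \<subseteq> {..<p} \<and> snd (g k) \<noteq> {} \<and> snd (g k) \<noteq> {..<p}"
    proof -
      have "card (snd (g k)) \<noteq> 0" "card (snd (g k)) \<noteq> p" using T(2)[OF k] m by (simp_all split: if_splits)
      then show ?thesis using T(1)[OF k] by auto
    qed
    show "\<not> {..<m} \<subseteq> snd (g k)" if "fst (g k)"
      using card_mono[OF \<open>finite (snd (g k))\<close>, of "{..<m}"] T(2)[OF k] that m by auto
    show "\<not> snd (g k) \<subseteq> {..<m}" if "\<not> fst (g k)"
      using card_subset_eq[of "{..<m}" "snd (g k)"] T(2,3)[OF k] that by auto
  next
    fix y y' assume "y < p" "y' < p" "y \<noteq> y'" "y < m \<or> m \<le> y'"
    then have "\<exists>x\<in>g ` {..<q}. y \<notin> snd x \<and> y' \<in> snd x"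
      using g(2) unfolding separating_def by blast
    then show "\<exists>k<q. y \<notin> snd (g k) \<and> y' \<in> snd (g k)" by auto
  qed (use g(2) uv in \<open>auto simp: separating_def D_def\<close>)
qed

text \<open>Either \<open>(0, 1)\<close> is a middle vertex, or the set of \<open>k\<close> is at
  least as large as that of \<open>l\<close>; for distinct pairs it is then not contained in the
  latter, and any \<open>j\<close> in the difference is a middle vertex.\<close>

lemma near_middle_inj_within_two:
  fixes p q m :: nat and g :: "nat \<Rightarrow> bool \<times> nat set"
  defines "D \<equiv> tripartite_orientation p q m g"
  assumes m: "0 < m" and g: "g ` {..<q} \<subseteq> near_middle p m" "inj_on g {..<q}"
    and kl: "k < q" "l < q"
  shows "within_two D (2, k) (2, l)"
proof (cases "k = l")
  case False
  note arcs = tripartite_arcs[of _ _ p q m g, folded D_def]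
  note arcs = arcs arcs[unfolded One_nat_def]
  have "(fst (g k), snd (g k)) \<in> near_middle p m" if "k < q" for k
    using g(1) that by auto
  then have T: "snd (g k) \<subseteq> {..<p}" "card (snd (g k)) = (if fst (g k) then m - 1 else m)" if "k < q" for k
    using that unfolding near_middle_iff by blast+
  have fin: "finite (snd (g l))" using T(1)[OF kl(2)] finite_subset by blast
  show ?thesis
  proof (cases "fst (g k) \<and> \<not> fst (g l)")
    case True
    then show ?thesis using kl by (intro within_twoI[of _ "(0, 1)"]) (simp_all add: arcs)
  next
    case s: False
    have "\<not> snd (g k) \<subseteq> snd (g l)"
    proof
      assume sub: "snd (g k) \<subseteq> snd (g l)"
      then have "card (snd (g k)) \<le> card (snd (g l))" using fin by (rule card_mono[rotated])
      then have eq: "fst (g k) = fst (g l)" using T(2)[OF kl(1)] T(2)[OF kl(2)] s m by (auto split: if_splits)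
      then have "snd (g k) = snd (g l)" using card_subset_eq[OF fin sub] T(2) kl by simp
      with eq have "g k = g l" by (simp add: prod_eq_iff)
      with g(2) kl False show False by (auto dest: inj_onD)
    qed
    then obtain j where "j \<in> snd (g k)" "j \<notin> snd (g l)" by blast
    then show ?thesis
      using T(1)[OF kl(1)] kl by (intro within_twoI[of _ "(1, j)"]) (auto simp: arcs)
  qed
qed (simp add: within_two_def)

section \<open>Bounds on the oriented diameter\<close>

lemma diam_orientation_ge_two:
  assumes D: "orientation (complete_tripartite 3 p q) D"
  shows "2 \<le> diam (with_proj D)"
proof -
  interpret pair_digraph D
    by (rule pair_digraph_orientation[OF pair_graph_complete_tripartite D])
  have V: "(0, 0) \<in> pverts D" "(0, 1) \<in> pverts D"
    using D by (auto simp: orientation_def pverts_complete_tripartite)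
  have "((0, 0), (0, 1)) \<notin> parcs D"
    using D by (auto simp: orientation_def parcs_complete_tripartite)
  then have "2 \<le> \<mu> (\<lambda>_. 1) (0, 0) (0, 1)" by (intro mu_ge_two) auto
  also have "\<dots> \<le> diam (with_proj D)" using V by (intro mu_le_diam) auto
  finally show ?thesis .
qed

lemma within_two_of_diam_less:
  assumes D: "orientation (complete_tripartite 3 p q) D" and lt: "diam (with_proj D) < 3"
    and uv: "u \<in> pverts D" "v \<in> pverts D"
  shows "within_two D u v"
proof -
  interpret pair_digraph D
    by (rule pair_digraph_orientation[OF pair_graph_complete_tripartite D])
  show ?thesis
    using mu_le_diam[of u v] uv lt by (intro within_two_mu) (auto intro: le_less_trans)
qed

lemma oriented_diameter_ge_two: "2 \<le> oriented_diameter (complete_tripartite 3 p q)"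
  unfolding oriented_diameter_def
  by (rule INF_greatest) (use diam_orientation_ge_two in \<open>auto simp: strong_orientation_def\<close>)

lemma tripartite_orientation_diam:
  fixes p q m :: nat and g :: "nat \<Rightarrow> bool \<times> nat set"
  defines "D \<equiv> tripartite_orientation p q m g"
  assumes m: "2 \<le> m" "m + 2 \<le> p" and g: "g ` {..<q} \<subseteq> near_middle p m" "separating p m (g ` {..<q})"
  shows "strong_orientation (complete_tripartite 3 p q) D" "diam (with_proj D) \<le> 3"
    and "inj_on g {..<q} \<Longrightarrow> diam (with_proj D) \<le> 2"
proof -
  have D: "orientation (complete_tripartite 3 p q) D"
    unfolding D_def by (rule orientation_tripartite)
  interpret pair_digraph D
    by (rule pair_digraph_orientation[OF pair_graph_complete_tripartite D])
  note arcs = tripartite_arcs[of _ _ p q m g, folded D_def]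
  have V: "pverts D = {0} \<times> {..<3} \<union> {1} \<times> {..<p} \<union> {2} \<times> {..<q}"
    using D by (simp add: orientation_def pverts_complete_tripartite)
  note two = near_middle_within_two[OF m g, folded D_def]
  have three: "\<exists>es. awalk u es v \<and> length es \<le> 3" if uv: "u \<in> pverts D" "v \<in> pverts D" for u v
  proof (cases "fst u = 2 \<and> fst v = 2")
    case True
    then obtain k where k: "u = (2, k)" "k < q" using uv(1) V by auto
    \<comment> \<open>Every vertex of the part of size \<open>q\<close> has an arc to
      \<open>(0, 0)\<close>, from which two more arcs suffice, even if pairs are repeated.\<close>
    have "((2, k), (0, 0)) \<in> parcs D" using k by (simp add: arcs)
    moreover have "within_two D (0, 0) v" using uv V by (intro two) auto
    then obtain es where "awalk (0, 0) es v" "length es \<le> 2"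
      by (rule within_two_awalk) (simp add: V)
    ultimately show ?thesis
      by (intro exI[of _ "((2, k), (0, 0)) # es"]) (simp add: awalk_Cons_iff k)
  next
    case False
    then have "within_two D u v" using uv by (intro two) auto
    then obtain es where "awalk u es v" "length es \<le> 2" using uv(1) by (rule within_two_awalk)
    then show ?thesis by (intro exI[of _ es]) simp
  qed
  have "(0, 0) \<in> pverts D" unfolding V by simp
  then have "strongly_connected (with_proj D)"
    using three by (intro strongly_connectedI_awalk) blast+
  with D show "strong_orientation (complete_tripartite 3 p q) D"
    by (simp add: strong_orientation_def)
  show "diam (with_proj D) \<le> 3" using diam_le[of 3] three by simp
  assume inj: "inj_on g {..<q}"
  have "\<exists>es. awalk u es v \<and> length es \<le> 2" if uv: "u \<in> pverts D" "v \<in> pverts D" for u v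
  proof -
    have "within_two D u v"
    proof (cases "fst u = 2 \<and> fst v = 2")
      case True
      then obtain k l where "u = (2, k)" "k < q" "v = (2, l)" "l < q" using uv V by auto
      then show ?thesis
        using near_middle_inj_within_two[of m g q p k l] m g(1) inj by (simp add: D_def)
    qed (use uv two in blast)
    then show ?thesis using uv(1) by (metis within_two_awalk)
  qed
  then show "diam (with_proj D) \<le> 2" using diam_le[of 2] by simp
qed

lemma oriented_diameter_le:
  assumes "strong_orientation G D" "diam (with_proj D) \<le> n"
  shows "oriented_diameter G \<le> n"
  unfolding oriented_diameter_def using assms by (auto intro: INF_lower2)

lemma lessThan_surjection:
  assumes "card B \<le> q" "B \<noteq> {}" "finite B"
  shows "\<exists>g :: nat \<Rightarrow> 'a. g ` {..<q} = B"
proof -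
  obtain h where h: "bij_betw h {..<card B} B"
    using ex_bij_betw_nat_finite[OF assms(3)] by (auto simp: atLeast0LessThan)
  \<comment> \<open>Surplus indices all repeat the value \<open>h 0\<close>, which exists because
    \<open>B\<close> is nonempty.\<close>
  have "(\<lambda>k. h (if k < card B then k else 0)) ` {..<q} = h ` {..<card B}"
  proof (intro equalityI subsetI)
    fix x assume "x \<in> (\<lambda>k. h (if k < card B then k else 0)) ` {..<q}"
    moreover have "0 < card B" using assms(2,3) by (simp add: card_gt_0_iff)
    ultimately show "x \<in> h ` {..<card B}" by (auto split: if_splits)
  next
    fix x assume "x \<in> h ` {..<card B}"
    then obtain k where "k < card B" "x = h k" by auto
    with assms(1) show "x \<in> (\<lambda>k. h (if k < card B then k else 0)) ` {..<q}"
      by (intro image_eqI[of _ _ k]) auto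
  qed
  then show ?thesis using h by (metis bij_betw_imp_surj_on)
qed

theorem theorem1p2:
  fixes p q :: nat
  assumes "5 \<le> p" and "p \<le> q"
  shows "oriented_diameter (complete_tripartite 3 p q) =
    (if q < (p + 1) choose ((p + 1) div 2) then 2 else 3)"
proof -
  define m where "m = (p + 1) div 2"
  have m: "2 \<le> m" "m + 2 \<le> p" using assms(1) by (auto simp: m_def)
  obtain B where B: "B \<subseteq> near_middle p m" "card B \<le> p" "separating p m B"
    using separating_family_exists[OF assms(1) m_def] by blast
  have fin: "finite B" using B(1) finite_near_middle finite_subset by blast
  show ?thesis
  proof (cases "q < (p + 1) choose ((p + 1) div 2)")
    case True
    then have "q \<le> card (near_middle p m)"
      using card_near_middle[of m p] m by (simp add: m_def)
    \<comment> \<open>Since \<open>card B <= p <= q\<close>, the separating family extends to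
      exactly \<open>q\<close> distinct pairs, and \<open>separating\<close> survives the
      enlargement.\<close>
    then obtain C where C: "B \<subseteq> C" "C \<subseteq> near_middle p m" "card C = q"
      using exists_subset_between[of B q "near_middle p m"] B assms(2) finite_near_middle by auto
    then have "finite C" using finite_near_middle finite_subset by blast
    then obtain g where g: "bij_betw g {..<q} C"
      using ex_bij_betw_nat_finite[of C] C(3) by (auto simp: atLeast0LessThan)
    then have im: "g ` {..<q} = C" and inj: "inj_on g {..<q}" by (auto simp: bij_betw_def)
    note g = tripartite_orientation_diam[OF m, of g q, unfolded im, OF C(2) separating_mono[OF B(3) C(1)]]
    have "oriented_diameter (complete_tripartite 3 p q) \<le> 2"
      by (rule oriented_diameter_le[OF g(1) g(3)[OF inj]])
    with oriented_diameter_ge_two True show ?thesis by (simp add: antisym)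
  next
    case False
    have "B \<noteq> {}" using B(3) m unfolding separating_def by fastforce
    then obtain g :: "nat \<Rightarrow> bool \<times> nat set" where im: "g ` {..<q} = B"
      using lessThan_surjection[of B q] B(2) assms(2) fin by auto
    note g = tripartite_orientation_diam[OF m, of g q, unfolded im, OF B(1,3)]
    have "oriented_diameter (complete_tripartite 3 p q) \<le> 3"
      by (rule oriented_diameter_le[OF g(1,2)])
    moreover have "3 \<le> oriented_diameter (complete_tripartite 3 p q)"
      unfolding oriented_diameter_def
    proof (rule INF_greatest)
      fix D assume "D \<in> {D. strong_orientation (complete_tripartite 3 p q) D}"
      then have D: "orientation (complete_tripartite 3 p q) D" by (simp add: strong_orientation_def)
      show "3 \<le> diam (with_proj D)"
      proof (rule ccontr)
        assume "\<not> 3 \<le> diam (with_proj D)"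
        then have "within_two D u v" if "u \<in> pverts D" "v \<in> pverts D" for u v
          using within_two_of_diam_less[OF D] that by simp
        then have "q < central (p + 1)"
          by (rule orientation_within_two_less[OF D assms(1)])
        with False show False by (simp add: central_def)
      qed
    qed
    ultimately show ?thesis using False by (simp add: antisym)
  qed
qed

end
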